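(* Let $(X,\mathscr A,\mu)$ be a $\sigma$-finite measure space and let $\phi$ be a nonsingular transformation of $X$. If $\mathcal D(C_\phi)$ is dense in $L^2(\mu)$, then the following are equivalent: (i) $C_\phi$ is normal; (ii) $\mathsf h_\phi=\mathsf h_\phi\circ\phi$ a.e. $[\mu]$ and $\mathcal N(C_\phi^* )\subseteq\mathcal N(C_\phi)$; (iii) $\mathsf h_\phi=\mathsf h_\phi\circ\phi$ a.e. $[\mu]$ and $\mathcal N(C_\phi^* )=\{0\}$; (iv) $\mathsf h_\phi=\mathsf h_\phi\circ\phi$ a.e. $[\mu]$ and for every $\Delta\in\mathscr A$ there exists $\Delta'\in\mathscr A$ such that $\mu(\Delta\,\triangle\,\phi^{-1}(\Delta'))=0$. Moreover, if $C_\phi$ is normal, then $\mathcal N(C_\phi)=\{0\}$ and $\mathsf h_\phi>0$ a.e. $[\mu]$.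
   Context: $L^2(\mu)$ is the complex Hilbert space of square integrable complex functions on $X$. A transformation $\phi\colon X\to X$ is nonsingular if $\phi^{-1}(\Delta)\in\mathscr A$ for all $\Delta\in\mathscr A$ and the measure $\mu\circ\phi^{-1}$, $\Delta\mapsto\mu(\phi^{-1}(\Delta))$, is absolutely continuous with respect to $\mu$. The composition operator $C_\phi$ in $L^2(\mu)$ is given by $\mathcal D(C_\phi)=\{f\in L^2(\mu)\colon f\circ\phi\in L^2(\mu)\}$, $C_\phi f=f\circ\phi$ (possibly unbounded). $\mathsf h_\phi\colon X\to[0,\infty]$ is the ($\mu$-a.e. unique) $\mathscr A$-measurable function with $\mu(\phi^{-1}(\Delta))=\int_\Delta\mathsf h_\phi\,d\mu$ for all $\Delta\in\mathscr A$. $\mathcal D(A)$ and $\mathcal N(A)$ denote the domain and the kernel of an operator $A$; $\triangle$ is symmetric difference. A densely defined operator $N$ in a complex Hilbert space is normal if $N$ is closed and $N^*N=NN^*$. *)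

theory Defs
  imports "HOL-Analysis.Analysis"
begin

section \<open>The Hilbert space of square integrable complex functions\<close>

text \<open>
  Elements are classes of square integrable functions modulo equality almost everywhere.
  Operations are computed on the representative \<open>L2_rep u\<close>, whose choice is immaterial.
\<close>

definition sq_integrable :: "'a measure \<Rightarrow> ('a \<Rightarrow> complex) set" where
  "sq_integrable M = {f \<in> borel_measurable M. integrable M (\<lambda>x. (cmod (f x))\<^sup>2)}"

definition ae_eq_rel :: "'a measure \<Rightarrow> (('a \<Rightarrow> complex) \<times> ('a \<Rightarrow> complex)) set" where
  "ae_eq_rel M = {(f, g). f \<in> sq_integrable M \<and> g \<in> sq_integrable M \<and> (AE x in M. f x = g x)}"

type_synonym 'a L2_elem = "('a \<Rightarrow> complex) set"

definition L2 :: "'a measure \<Rightarrow> 'a L2_elem set" where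
  "L2 M = sq_integrable M // ae_eq_rel M"

definition L2_class :: "'a measure \<Rightarrow> ('a \<Rightarrow> complex) \<Rightarrow> 'a L2_elem" where
  "L2_class M f = ae_eq_rel M `` {f}"

definition L2_rep :: "'a L2_elem \<Rightarrow> 'a \<Rightarrow> complex" where
  "L2_rep u = (SOME f. f \<in> u)"

definition L2_zero :: "'a measure \<Rightarrow> 'a L2_elem" where
  "L2_zero M = L2_class M (\<lambda>x. 0)"

definition L2_add :: "'a measure \<Rightarrow> 'a L2_elem \<Rightarrow> 'a L2_elem \<Rightarrow> 'a L2_elem" where
  "L2_add M u v = L2_class M (\<lambda>x. L2_rep u x + L2_rep v x)"

definition L2_scale :: "'a measure \<Rightarrow> complex \<Rightarrow> 'a L2_elem \<Rightarrow> 'a L2_elem" where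
  "L2_scale M c u = L2_class M (\<lambda>x. c * L2_rep u x)"

definition L2_inner :: "'a measure \<Rightarrow> 'a L2_elem \<Rightarrow> 'a L2_elem \<Rightarrow> complex" where
  "L2_inner M u v = (\<integral>x. L2_rep u x * cnj (L2_rep v x) \<partial>M)"

definition L2_dist :: "'a measure \<Rightarrow> 'a L2_elem \<Rightarrow> 'a L2_elem \<Rightarrow> real" where
  "L2_dist M u v = sqrt (\<integral>x. (cmod (L2_rep u x - L2_rep v x))\<^sup>2 \<partial>M)"


section \<open>Unbounded operators\<close>

text \<open>
  An operator is identified with its graph, so that equality of operators includes equality
  of their domains, and \<open>Domain A\<close> is the domain of \<open>A\<close>.
\<close>

type_synonym 'a L2_op = "('a L2_elem \<times> 'a L2_elem) set"

definition linear_op :: "'a measure \<Rightarrow> 'a L2_op \<Rightarrow> bool" where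
  "linear_op M A \<longleftrightarrow>
     A \<subseteq> L2 M \<times> L2 M \<and> single_valued A \<and> (L2_zero M, L2_zero M) \<in> A \<and>
     (\<forall>u v u' v'. (u, v) \<in> A \<longrightarrow> (u', v') \<in> A \<longrightarrow> (L2_add M u u', L2_add M v v') \<in> A) \<and>
     (\<forall>c u v. (u, v) \<in> A \<longrightarrow> (L2_scale M c u, L2_scale M c v) \<in> A)"

definition dense_in_L2 :: "'a measure \<Rightarrow> 'a L2_elem set \<Rightarrow> bool" where
  "dense_in_L2 M D \<longleftrightarrow> (\<forall>u \<in> L2 M. \<forall>e > 0. \<exists>v \<in> D. L2_dist M u v < e)"

definition closed_op :: "'a measure \<Rightarrow> 'a L2_op \<Rightarrow> bool" where
  "closed_op M A \<longleftrightarrow>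
     (\<forall>s t u v. (\<forall>n::nat. (s n, t n) \<in> A) \<longrightarrow> u \<in> L2 M \<longrightarrow> v \<in> L2 M \<longrightarrow>
        (\<lambda>n. L2_dist M (s n) u) \<longlonglongrightarrow> 0 \<longrightarrow> (\<lambda>n. L2_dist M (t n) v) \<longlonglongrightarrow> 0 \<longrightarrow> (u, v) \<in> A)"

definition kernel_op :: "'a measure \<Rightarrow> 'a L2_op \<Rightarrow> 'a L2_elem set" where
  "kernel_op M A = {u. (u, L2_zero M) \<in> A}"

text \<open>For densely defined \<open>A\<close> the following graph is single-valued.\<close>

definition adjoint_op :: "'a measure \<Rightarrow> 'a L2_op \<Rightarrow> 'a L2_op" where
  "adjoint_op M A =
     {(v, w). v \<in> L2 M \<and> w \<in> L2 M \<and> (\<forall>(u, u') \<in> A. L2_inner M u' v = L2_inner M u w)}"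

text \<open>Relational composition \<open>A O B\<close> applies \<open>A\<close> first, that is, it is the operator product \<open>BA\<close>.\<close>

definition normal_op :: "'a measure \<Rightarrow> 'a L2_op \<Rightarrow> bool" where
  "normal_op M N \<longleftrightarrow>
     linear_op M N \<and> dense_in_L2 M (Domain N) \<and> closed_op M N \<and>
     N O adjoint_op M N = adjoint_op M N O N"


section \<open>Composition operators\<close>

definition nonsingular :: "'a measure \<Rightarrow> ('a \<Rightarrow> 'a) \<Rightarrow> bool" where
  "nonsingular M \<phi> \<longleftrightarrow> \<phi> \<in> measurable M M \<and> absolutely_continuous M (distr M M \<phi>)"

definition comp_op :: "'a measure \<Rightarrow> ('a \<Rightarrow> 'a) \<Rightarrow> 'a L2_op" where
  "comp_op M \<phi> = {(L2_class M f, L2_class M (f \<circ> \<phi>)) | f.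
      f \<in> sq_integrable M \<and> f \<circ> \<phi> \<in> sq_integrable M}"

definition h_deriv :: "'a measure \<Rightarrow> ('a \<Rightarrow> 'a) \<Rightarrow> 'a \<Rightarrow> ennreal" where
  "h_deriv M \<phi> = RN_deriv M (distr M M \<phi>)"


section \<open>Consistency of the definitions\<close>

lemma h_deriv_measurable: "h_deriv M \<phi> \<in> borel_measurable M"
  by (simp add: h_deriv_def)

lemma emeasure_vimage_h_deriv:
  assumes "sigma_finite_measure M" "nonsingular M \<phi>" "\<Delta> \<in> sets M"
  shows "emeasure M (\<phi> -` \<Delta> \<inter> space M) = (\<integral>\<^sup>+x\<in>\<Delta>. h_deriv M \<phi> x \<partial>M)"
proof -
  interpret sigma_finite_measure M by fact
  have "density M (h_deriv M \<phi>) = distr M M \<phi>"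
    using assms(2) unfolding h_deriv_def nonsingular_def by (intro density_RN_deriv) auto
  then have "emeasure (distr M M \<phi>) \<Delta> = (\<integral>\<^sup>+x\<in>\<Delta>. h_deriv M \<phi> x \<partial>M)"
    using assms(3) by (metis emeasure_density h_deriv_measurable)
  then show ?thesis
    using assms(2,3) by (simp add: emeasure_distr nonsingular_def)
qed

lemma equiv_ae_eq_rel: "equiv (sq_integrable M) (ae_eq_rel M)"
proof (rule equivI)
  show "ae_eq_rel M \<subseteq> sq_integrable M \<times> sq_integrable M"
    by (auto simp: ae_eq_rel_def)
  show "refl_on (sq_integrable M) (ae_eq_rel M)"
    by (auto simp: refl_on_def ae_eq_rel_def)
  show "sym (ae_eq_rel M)"
    by (auto simp: sym_def ae_eq_rel_def)
  show "trans (ae_eq_rel M)"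
  proof (rule transI)
    fix f g h assume fg: "(f, g) \<in> ae_eq_rel M" and gh: "(g, h) \<in> ae_eq_rel M"
    then have "AE x in M. f x = g x" "AE x in M. g x = h x"
      by (auto simp: ae_eq_rel_def)
    then have "AE x in M. f x = h x"
      by eventually_elim simp
    then show "(f, h) \<in> ae_eq_rel M"
      using fg gh by (simp add: ae_eq_rel_def)
  qed
qed

lemma L2_class_eq_iff:
  assumes "f \<in> sq_integrable M" "g \<in> sq_integrable M"
  shows "L2_class M f = L2_class M g \<longleftrightarrow> (AE x in M. f x = g x)"
  using eq_equiv_class_iff[OF equiv_ae_eq_rel assms] assms
  by (simp add: L2_class_def ae_eq_rel_def)

lemma L2_class_in_L2: "f \<in> sq_integrable M \<Longrightarrow> L2_class M f \<in> L2 M"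
  by (simp add: L2_def L2_class_def quotientI)

lemma L2_rep_class:
  assumes "f \<in> sq_integrable M"
  shows "L2_rep (L2_class M f) \<in> sq_integrable M" "AE x in M. L2_rep (L2_class M f) x = f x"
proof -
  have "f \<in> L2_class M f"
    using assms by (simp add: L2_class_def ae_eq_rel_def)
  then have "L2_rep (L2_class M f) \<in> L2_class M f"
    unfolding L2_rep_def by (rule someI[where P = "\<lambda>g. g \<in> L2_class M f"])
  then have "(f, L2_rep (L2_class M f)) \<in> ae_eq_rel M"
    by (simp add: L2_class_def)
  then show "L2_rep (L2_class M f) \<in> sq_integrable M" "AE x in M. L2_rep (L2_class M f) x = f x"
    by (auto simp: ae_eq_rel_def)
qed

lemma sq_integrable_add:
  assumes "f \<in> sq_integrable M" "g \<in> sq_integrable M"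
  shows "(\<lambda>x. f x + g x) \<in> sq_integrable M"
proof -
  have [measurable]: "f \<in> borel_measurable M" "g \<in> borel_measurable M"
    using assms by (auto simp: sq_integrable_def)
  have "(cmod (a + b))\<^sup>2 \<le> 2 * (cmod a)\<^sup>2 + 2 * (cmod b)\<^sup>2" for a b
  proof -
    have "(cmod (a + b))\<^sup>2 \<le> (cmod a + cmod b)\<^sup>2"
      by (simp add: norm_triangle_ineq power_mono)
    also have "\<dots> \<le> 2 * (cmod a)\<^sup>2 + 2 * (cmod b)\<^sup>2"
      using zero_le_power2[of "cmod a - cmod b"] by (simp add: power2_sum power2_diff)
    finally show ?thesis .
  qed
  then have bound: "norm ((cmod (f x + g x))\<^sup>2) \<le> norm (2 * (cmod (f x))\<^sup>2 + 2 * (cmod (g x))\<^sup>2)" for x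
    by simp
  have "integrable M (\<lambda>x. 2 * (cmod (f x))\<^sup>2 + 2 * (cmod (g x))\<^sup>2)"
    using assms by (simp add: sq_integrable_def)
  moreover have "(\<lambda>x. (cmod (f x + g x))\<^sup>2) \<in> borel_measurable M"
    by measurable
  ultimately have "integrable M (\<lambda>x. (cmod (f x + g x))\<^sup>2)"
    by (rule Bochner_Integration.integrable_bound) (rule AE_I2, rule bound)
  then show ?thesis
    by (simp add: sq_integrable_def)
qed

lemma sq_integrable_scale:
  assumes "f \<in> sq_integrable M"
  shows "(\<lambda>x. c * f x) \<in> sq_integrable M"
  using assms by (auto simp: sq_integrable_def norm_mult power_mult_distrib)

lemma L2_add_class:
  assumes "f \<in> sq_integrable M" "g \<in> sq_integrable M"
  shows "L2_add M (L2_class M f) (L2_class M g) = L2_class M (\<lambda>x. f x + g x)"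
proof -
  have "AE x in M. L2_rep (L2_class M f) x + L2_rep (L2_class M g) x = f x + g x"
    using L2_rep_class(2)[OF assms(1)] L2_rep_class(2)[OF assms(2)] by eventually_elim simp
  then show ?thesis
    using assms by (simp add: L2_add_def L2_class_eq_iff sq_integrable_add L2_rep_class(1))
qed

lemma L2_scale_class:
  assumes "f \<in> sq_integrable M"
  shows "L2_scale M c (L2_class M f) = L2_class M (\<lambda>x. c * f x)"
proof -
  have "AE x in M. c * L2_rep (L2_class M f) x = c * f x"
    using L2_rep_class(2)[OF assms] by eventually_elim simp
  then show ?thesis
    using assms by (simp add: L2_scale_def L2_class_eq_iff sq_integrable_scale L2_rep_class(1))
qed

lemma L2_inner_class:
  assumes "f \<in> sq_integrable M" "g \<in> sq_integrable M"
  shows "L2_inner M (L2_class M f) (L2_class M g) = (\<integral>x. f x * cnj (g x) \<partial>M)"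
proof -
  have cnj_measurable [measurable]: "cnj \<in> borel_measurable borel"
    by (intro borel_measurable_continuous_onI continuous_intros)
  have [measurable]: "f \<in> borel_measurable M" "g \<in> borel_measurable M"
    "L2_rep (L2_class M f) \<in> borel_measurable M" "L2_rep (L2_class M g) \<in> borel_measurable M"
    using assms assms[THEN L2_rep_class(1)] by (auto simp: sq_integrable_def)
  have "AE x in M. L2_rep (L2_class M f) x * cnj (L2_rep (L2_class M g) x) = f x * cnj (g x)"
    using L2_rep_class(2)[OF assms(1)] L2_rep_class(2)[OF assms(2)] by eventually_elim simp
  then show ?thesis
    unfolding L2_inner_def by (intro integral_cong_AE) measurable
qed

lemma AE_nonsingular:
  assumes "nonsingular M \<phi>" "AE x in M. P x"
  shows "AE x in M. P (\<phi> x)"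
proof -
  have meas: "\<phi> \<in> measurable M M" and ac: "null_sets M \<subseteq> null_sets (distr M M \<phi>)"
    using assms(1) by (auto simp: nonsingular_def absolutely_continuous_def)
  obtain N where N: "N \<in> null_sets M" "{x \<in> space M. \<not> P x} \<subseteq> N"
    using assms(2) by (auto simp: eventually_ae_filter)
  then have "\<phi> -` N \<inter> space M \<in> null_sets M"
    using ac meas by (auto simp: null_sets_distr_iff)
  moreover have "{x \<in> space M. \<not> P (\<phi> x)} \<subseteq> \<phi> -` N \<inter> space M"
    using N(2) measurable_space[OF meas] by auto
  ultimately show ?thesis
    unfolding eventually_ae_filter by blast
qed

lemma linear_op_comp_op:
  assumes "nonsingular M \<phi>"
  shows "linear_op M (comp_op M \<phi>)"
  unfolding linear_op_def
proof (intro conjI allI impI)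
  show "comp_op M \<phi> \<subseteq> L2 M \<times> L2 M"
    by (auto simp: comp_op_def L2_class_in_L2)
  show "single_valued (comp_op M \<phi>)"
  proof (rule single_valuedI)
    fix u v w assume "(u, v) \<in> comp_op M \<phi>" "(u, w) \<in> comp_op M \<phi>"
    then obtain f g where
      f: "f \<in> sq_integrable M" "f \<circ> \<phi> \<in> sq_integrable M" "u = L2_class M f" "v = L2_class M (f \<circ> \<phi>)" and
      g: "g \<in> sq_integrable M" "g \<circ> \<phi> \<in> sq_integrable M" "u = L2_class M g" "w = L2_class M (g \<circ> \<phi>)"
      unfolding comp_op_def by blast
    have "AE x in M. f x = g x"
      using f(3) g(3) L2_class_eq_iff[OF f(1) g(1)] by simp
    then have "AE x in M. (f \<circ> \<phi>) x = (g \<circ> \<phi>) x"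
      unfolding comp_def by (rule AE_nonsingular[OF assms])
    then show "v = w"
      using f(4) g(4) L2_class_eq_iff[OF f(2) g(2)] by simp
  qed
  have "(\<lambda>x. 0) \<in> sq_integrable M"
    by (simp add: sq_integrable_def)
  then show "(L2_zero M, L2_zero M) \<in> comp_op M \<phi>"
    unfolding comp_op_def L2_zero_def
    by (intro CollectI exI[of _ "\<lambda>x. 0"]) (simp add: comp_def)
next
  fix u v u' v' assume "(u, v) \<in> comp_op M \<phi>" "(u', v') \<in> comp_op M \<phi>"
  then obtain f g where
    f: "f \<in> sq_integrable M" "f \<circ> \<phi> \<in> sq_integrable M" "u = L2_class M f" "v = L2_class M (f \<circ> \<phi>)" and
    g: "g \<in> sq_integrable M" "g \<circ> \<phi> \<in> sq_integrable M" "u' = L2_class M g" "v' = L2_class M (g \<circ> \<phi>)"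
    unfolding comp_op_def by blast
  have *: "(\<lambda>x. f x + g x) \<circ> \<phi> = (\<lambda>x. (f \<circ> \<phi>) x + (g \<circ> \<phi>) x)"
    by auto
  show "(L2_add M u u', L2_add M v v') \<in> comp_op M \<phi>"
    unfolding comp_op_def f(3,4) g(3,4)
    by (intro CollectI exI[of _ "\<lambda>x. f x + g x"] conjI)
       (simp_all only: * L2_add_class sq_integrable_add f(1,2) g(1,2))
next
  fix c u v assume "(u, v) \<in> comp_op M \<phi>"
  then obtain f where
    f: "f \<in> sq_integrable M" "f \<circ> \<phi> \<in> sq_integrable M" "u = L2_class M f" "v = L2_class M (f \<circ> \<phi>)"
    unfolding comp_op_def by blast
  have *: "(\<lambda>x. c * f x) \<circ> \<phi> = (\<lambda>x. c * (f \<circ> \<phi>) x)"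
    by auto
  show "(L2_scale M c u, L2_scale M c v) \<in> comp_op M \<phi>"
    unfolding comp_op_def f(3,4)
    by (intro CollectI exI[of _ "\<lambda>x. c * f x"] conjI)
       (simp_all only: * L2_scale_class sq_integrable_scale f(1,2))
qed

end

theory Submission
  imports Defs
begin

text \<open>
  Density of the domain forces \<open>h < \<infinity>\<close> a.e., so \<open>h\<close> may be replaced by a real function \<open>H\<close>, and
  \<open>C\<^sup>*C\<close> is always multiplication by \<open>H\<close> on its maximal domain. When every set is a.e. a preimage
  under \<open>\<phi>\<close>, every function in \<open>L\<^sup>2\<close> has the form \<open>g \<circ> \<phi>\<close> and \<open>C\<^sup>*(g \<circ> \<phi>) = H g\<close>; with
  \<open>H = H \<circ> \<phi>\<close> this makes \<open>CC\<^sup>*\<close> multiplication by \<open>H\<close> as well.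
  For a set \<open>D\<close> let \<open>k\<close> be the density of \<open>A \<mapsto> \<mu>(D \<inter> \<phi>\<^sup>-\<^sup>1 A)\<close>, so that \<open>0 \<le> k \<le> H\<close>.
  Then \<open>1\<^sub>D - (k / H) \<circ> \<phi>\<close> lies in the kernel of \<open>C\<^sup>*\<close>, so triviality of that kernel makes \<open>D\<close> a
  preimage. If \<open>C\<close> is normal, then \<open>C\<^sup>*1\<^sub>D = k\<close> gives \<open>k \<circ> \<phi> = H 1\<^sub>D\<close>. Taking \<open>D\<close> inside
  \<open>{H = 0}\<close> yields \<open>H > 0\<close>, and then \<open>D\<close> is the preimage of \<open>{k > 0}\<close>, so \<open>k\<close> equals \<open>H\<close> there and
  \<open>H = H \<circ> \<phi>\<close> on \<open>D\<close>.
\<close>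

section \<open>Square integrable functions and their classes\<close>

lemma cnj_borel_measurable [measurable]: "cnj \<in> borel_measurable borel"
  by (intro borel_measurable_continuous_onI continuous_intros)

lemma sq_integrable_measurable: "f \<in> sq_integrable M \<Longrightarrow> f \<in> borel_measurable M"
  by (simp add: sq_integrable_def)

lemma sq_integrable_bound:
  assumes "f \<in> borel_measurable M" "integrable M (g :: 'a \<Rightarrow> real)" "AE x in M. (cmod (f x))\<^sup>2 \<le> g x"
  shows "f \<in> sq_integrable M"
proof -
  have [measurable]: "f \<in> borel_measurable M" by fact
  have "integrable M (\<lambda>x. (cmod (f x))\<^sup>2)"
    by (rule Bochner_Integration.integrable_bound[OF assms(2)]) (use assms(3) in auto)
  then show ?thesis
    by (simp add: sq_integrable_def)
qed

lemma sq_integrable_cong_AE: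
  assumes "f \<in> sq_integrable M" "g \<in> borel_measurable M" "AE x in M. f x = g x"
  shows "g \<in> sq_integrable M"
  using assms by (intro sq_integrable_bound[of g M "\<lambda>x. (cmod (f x))\<^sup>2"]) (auto simp: sq_integrable_def)

lemma sq_integrable_diff:
  "f \<in> sq_integrable M \<Longrightarrow> g \<in> sq_integrable M \<Longrightarrow> (\<lambda>x. f x - g x) \<in> sq_integrable M"
  using sq_integrable_add[of f M "\<lambda>x. (-1) * g x"] sq_integrable_scale[of g M "-1"] by simp

lemma sq_integrable_zero [simp]: "(\<lambda>x. 0) \<in> sq_integrable M"
  by (simp add: sq_integrable_def)

lemma sq_integrable_indicator:
  assumes "A \<in> sets M" "emeasure M A < \<infinity>"
  shows "indicator A \<in> sq_integrable M"
  using assms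
  by (intro sq_integrable_bound[of _ M "indicator A"])
     (auto simp: indicator_def)

lemma integrable_mult_cnj:
  assumes "f \<in> sq_integrable M" "g \<in> sq_integrable M"
  shows "integrable M (\<lambda>x. f x * cnj (g x))"
proof (rule Bochner_Integration.integrable_bound)
  show "integrable M (\<lambda>x. (cmod (f x))\<^sup>2 + (cmod (g x))\<^sup>2)"
    using assms by (auto simp: sq_integrable_def)
  have [measurable]: "f \<in> borel_measurable M" "g \<in> borel_measurable M"
    using assms by (auto simp: sq_integrable_def)
  show "(\<lambda>x. f x * cnj (g x)) \<in> borel_measurable M"
    by measurable
  have "cmod (f x) * cmod (g x) \<le> (cmod (f x))\<^sup>2 + (cmod (g x))\<^sup>2" for x
    using sum_squares_bound[of "cmod (f x)" "cmod (g x)"] mult_nonneg_nonneg[of "cmod (f x)" "cmod (g x)"]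
    by (simp del: mult_nonneg_nonneg)
  then show "AE x in M. norm (f x * cnj (g x)) \<le> norm ((cmod (f x))\<^sup>2 + (cmod (g x))\<^sup>2)"
    by (simp add: norm_mult)
qed

lemma L2_cases:
  assumes "u \<in> L2 M"
  obtains f where "f \<in> sq_integrable M" "u = L2_class M f"
  using assms unfolding L2_def L2_class_def by (rule quotientE) blast

lemma L2_class_eqI:
  "f \<in> sq_integrable M \<Longrightarrow> g \<in> sq_integrable M \<Longrightarrow> (AE x in M. f x = g x) \<Longrightarrow> L2_class M f = L2_class M g"
  by (simp add: L2_class_eq_iff)

lemma L2_dist_class:
  assumes "f \<in> sq_integrable M" "g \<in> sq_integrable M"
  shows "L2_dist M (L2_class M f) (L2_class M g) = sqrt (\<integral>x. (cmod (f x - g x))\<^sup>2 \<partial>M)"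
proof -
  note [measurable] = assms[THEN sq_integrable_measurable]
    L2_rep_class(1)[OF assms(1), THEN sq_integrable_measurable]
    L2_rep_class(1)[OF assms(2), THEN sq_integrable_measurable]
  have "AE x in M. (cmod (L2_rep (L2_class M f) x - L2_rep (L2_class M g) x))\<^sup>2 = (cmod (f x - g x))\<^sup>2"
    using L2_rep_class(2)[OF assms(1)] L2_rep_class(2)[OF assms(2)] by eventually_elim simp
  then show ?thesis
    unfolding L2_dist_def by (intro arg_cong[of _ _ sqrt] integral_cong_AE) measurable
qed

section \<open>Closedness of the composition operator\<close>

text \<open>Convergence in the \<open>L2\<close> distance is L1 convergence to 0 of the squared
  moduli of the differences, and an L1 null sequence has an a.e. null subsequence.\<close>

lemma L2_tendsto_AE_subseq:
  assumes "\<And>n::nat. f n \<in> sq_integrable M" "g \<in> sq_integrable M"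
    and "(\<lambda>n. L2_dist M (L2_class M (f n)) (L2_class M g)) \<longlonglongrightarrow> 0"
  obtains r :: "nat \<Rightarrow> nat" where "strict_mono r" "AE x in M. (\<lambda>n. f (r n) x) \<longlonglongrightarrow> g x"
proof -
  have "(\<lambda>n. sqrt (\<integral>x. (cmod (f n x - g x))\<^sup>2 \<partial>M)) \<longlonglongrightarrow> 0"
    using assms(3) by (simp add: L2_dist_class assms)
  then have "(\<lambda>n. (sqrt (\<integral>x. (cmod (f n x - g x))\<^sup>2 \<partial>M))\<^sup>2) \<longlonglongrightarrow> 0\<^sup>2"
    by (intro tendsto_power)
  then have lim: "(\<lambda>n. \<integral>x. norm ((cmod (f n x - g x))\<^sup>2) \<partial>M) \<longlonglongrightarrow> 0"
    by simp
  have "integrable M (\<lambda>x. (cmod (f n x - g x))\<^sup>2)" for n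
    using sq_integrable_diff[OF assms(1) assms(2)] by (simp add: sq_integrable_def)
  from tendsto_L1_AE_subseq[OF this lim] obtain r :: "nat \<Rightarrow> nat" where
    r: "strict_mono r" "AE x in M. (\<lambda>n. (cmod (f (r n) x - g x))\<^sup>2) \<longlonglongrightarrow> 0"
    by auto
  from r(2) have "AE x in M. (\<lambda>n. f (r n) x) \<longlonglongrightarrow> g x"
  proof eventually_elim
    case (elim x)
    then have "(\<lambda>n. sqrt ((cmod (f (r n) x - g x))\<^sup>2)) \<longlonglongrightarrow> sqrt 0"
      by (rule tendsto_real_sqrt)
    then have "(\<lambda>n. cmod (f (r n) x - g x)) \<longlonglongrightarrow> 0"
      by simp
    then show ?case
      by (simp add: tendsto_norm_zero_iff LIM_zero_iff)
  qed
  with r(1) show ?thesis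
    by (rule that)
qed

text \<open>A first subsequence gives \<open>f n\<close> tending to \<open>a\<close> a.e., and a
  further one gives \<open>f n \<circ> \<phi>\<close> tending to \<open>b\<close> a.e.
  Nonsingularity carries the first limit along \<open>\<phi>\<close>, so uniqueness of limits forces
  \<open>b = a \<circ> \<phi>\<close> a.e.\<close>

lemma closed_comp_op:
  assumes "nonsingular M \<phi>"
  shows "closed_op M (comp_op M \<phi>)"
  unfolding closed_op_def
proof (intro allI impI)
  fix s t u v
  assume "\<forall>n::nat. (s n, t n) \<in> comp_op M \<phi>" and "u \<in> L2 M" "v \<in> L2 M"
    and lim: "(\<lambda>n. L2_dist M (s n) u) \<longlonglongrightarrow> 0" "(\<lambda>n. L2_dist M (t n) v) \<longlonglongrightarrow> 0"
  then have "\<forall>n. \<exists>f. f \<in> sq_integrable M \<and> f \<circ> \<phi> \<in> sq_integrable M \<and>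
      s n = L2_class M f \<and> t n = L2_class M (f \<circ> \<phi>)"
    by (fastforce simp: comp_op_def)
  then obtain f where f: "\<And>n. f n \<in> sq_integrable M" "\<And>n. f n \<circ> \<phi> \<in> sq_integrable M"
      "\<And>n. s n = L2_class M (f n)" "\<And>n. t n = L2_class M (f n \<circ> \<phi>)"
    by metis
  obtain a where a: "a \<in> sq_integrable M" "u = L2_class M a"
    using \<open>u \<in> L2 M\<close> by (rule L2_cases)
  obtain b where b: "b \<in> sq_integrable M" "v = L2_class M b"
    using \<open>v \<in> L2 M\<close> by (rule L2_cases)
  have [measurable]: "\<phi> \<in> measurable M M" "a \<in> borel_measurable M"
    using assms a(1) by (auto simp: nonsingular_def sq_integrable_def)
  obtain r :: "nat \<Rightarrow> nat" where r: "strict_mono r" "AE x in M. (\<lambda>n. f (r n) x) \<longlonglongrightarrow> a x"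
    using L2_tendsto_AE_subseq[of f M a, OF f(1) a(1)] lim(1) f(3) a(2) by auto
  have "(\<lambda>n. L2_dist M (t (r n)) v) \<longlonglongrightarrow> 0"
    using LIMSEQ_subseq_LIMSEQ[OF lim(2) r(1)] by (simp add: comp_def)
  then obtain q :: "nat \<Rightarrow> nat" where
    q: "strict_mono q" "AE x in M. (\<lambda>n. (f (r (q n)) \<circ> \<phi>) x) \<longlonglongrightarrow> b x"
    using L2_tendsto_AE_subseq[of "\<lambda>n. f (r n) \<circ> \<phi>" M b, OF f(2) b(1)] using f(4) b(2) by auto
  have "AE x in M. b x = (a \<circ> \<phi>) x"
    using q(2) AE_nonsingular[OF assms r(2)]
  proof eventually_elim
    case (elim x)
    from LIMSEQ_subseq_LIMSEQ[OF elim(2) q(1)] elim(1) show ?case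
      by (intro LIMSEQ_unique[OF elim(1)]) (simp add: comp_def)
  qed
  moreover from this have ac: "a \<circ> \<phi> \<in> sq_integrable M"
    by (intro sq_integrable_cong_AE[OF b(1)]) (auto simp: comp_def)
  ultimately have "v = L2_class M (a \<circ> \<phi>)"
    unfolding b(2) by (intro L2_class_eqI b(1))
  with a ac show "(u, v) \<in> comp_op M \<phi>"
    unfolding comp_op_def by blast
qed

section \<open>Change of variables and finiteness of the density\<close>

text \<open>A weighted change of variables. It serves two choices of weight: \<open>w = 1\<close>
  with \<open>k = H\<close>, and \<open>w\<close> the indicator of a set with \<open>k\<close> the
  density of the image of the restricted measure.\<close>

lemma integral_transfer:
  fixes g :: "'a \<Rightarrow> 'b :: {banach, second_countable_topology}" and w k :: "'a \<Rightarrow> real"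
  assumes [measurable]: "\<phi> \<in> measurable M M" "w \<in> borel_measurable M" "k \<in> borel_measurable M"
      "g \<in> borel_measurable M"
    and nonneg: "\<And>x. 0 \<le> w x" "\<And>x. 0 \<le> k x"
    and eq: "density M k = distr (density M w) M \<phi>"
  shows "integrable M (\<lambda>x. w x *\<^sub>R g (\<phi> x)) \<longleftrightarrow> integrable M (\<lambda>x. k x *\<^sub>R g x)"
    and "(\<integral>x. w x *\<^sub>R g (\<phi> x) \<partial>M) = (\<integral>x. k x *\<^sub>R g x \<partial>M)"
proof -
  have [measurable]: "\<phi> \<in> measurable (density M w) M"
    by simp
  have "integrable (density M k) g \<longleftrightarrow> integrable (density M w) (\<lambda>x. g (\<phi> x))"
    unfolding eq by (intro integrable_distr_eq) measurable
  then show "integrable M (\<lambda>x. w x *\<^sub>R g (\<phi> x)) \<longleftrightarrow> integrable M (\<lambda>x. k x *\<^sub>R g x)"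
    by (simp add: integrable_density nonneg)
  have "integral\<^sup>L (density M k) g = integral\<^sup>L (density M w) (\<lambda>x. g (\<phi> x))"
    unfolding eq by (intro integral_distr) measurable
  then show "(\<integral>x. w x *\<^sub>R g (\<phi> x) \<partial>M) = (\<integral>x. k x *\<^sub>R g x \<partial>M)"
    by (simp add: integral_density nonneg)
qed

text \<open>The integral of \<open>h |f|\<^sup>2\<close> is the squared norm of
  \<open>f \<circ> \<phi>\<close>, so every \<open>f\<close> in the domain vanishes a.e. where the
  derivative is infinite. If that set had a part \<open>B\<close> of positive finite measure, the
  indicator of \<open>B\<close> would stay at distance at least \<open>sqrt (measure M B)\<close>
  from the domain.\<close>

lemma dense_imp_h_deriv_finite:
  assumes "sigma_finite_measure M" "nonsingular M \<phi>" "dense_in_L2 M (Domain (comp_op M \<phi>))"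
  shows "AE x in M. h_deriv M \<phi> x < \<infinity>"
proof -
  interpret sigma_finite_measure M by fact
  let ?h = "h_deriv M \<phi>"
  note h_deriv_measurable[measurable]
  have [measurable]: "\<phi> \<in> measurable M M" and ac: "absolutely_continuous M (distr M M \<phi>)"
    using assms(2) by (auto simp: nonsingular_def)
  have dens: "density M ?h = distr M M \<phi>"
    unfolding h_deriv_def using ac by (intro density_RN_deriv) auto
  obtain A :: "nat \<Rightarrow> 'a set" where A: "range A \<subseteq> sets M" "(\<Union>i. A i) = space M"
      "\<And>i. emeasure M (A i) \<noteq> \<infinity>"
    using sigma_finite by blast
  note A(1)[THEN subsetD, OF rangeI, measurable]
  have "AE x in M. x \<notin> {x \<in> A i. ?h x = \<infinity>}" for i
  proof -
    define B where "B = {x \<in> A i. ?h x = \<infinity>}"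
    have "B = A i \<inter> {x \<in> space M. ?h x = \<infinity>}"
      unfolding B_def using A by auto
    then have [measurable]: "B \<in> sets M"
      by simp
    have fin: "emeasure M B < \<infinity>"
      using A(3)[of i] emeasure_mono[of B "A i" M] by (auto simp: B_def less_top[symmetric] top_unique)
    have B_sq: "indicator B \<in> sq_integrable M"
      by (rule sq_integrable_indicator) (use fin in auto)
    have "measure M B = 0"
    proof (rule ccontr)
      assume "measure M B \<noteq> 0"
      then have "sqrt (measure M B) > 0"
        by (simp add: zero_less_measure_iff)
      then obtain v where v: "v \<in> Domain (comp_op M \<phi>)"
          "L2_dist M (L2_class M (indicator B)) v < sqrt (measure M B)"
        using assms(3) L2_class_in_L2[OF B_sq] unfolding dense_in_L2_def by blast
      then obtain f where f: "f \<in> sq_integrable M" "f \<circ> \<phi> \<in> sq_integrable M" "v = L2_class M f"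
        by (auto simp: comp_op_def)
      note [measurable] = sq_integrable_measurable[OF f(1)]
      have "(\<integral>\<^sup>+x. ?h x * ennreal ((cmod (f x))\<^sup>2) \<partial>M) = (\<integral>\<^sup>+x. ennreal ((cmod (f x))\<^sup>2) \<partial>density M ?h)"
        by (simp add: nn_integral_density)
      also have "\<dots> = (\<integral>\<^sup>+x. ennreal ((cmod (f (\<phi> x)))\<^sup>2) \<partial>M)"
        unfolding dens by (simp add: nn_integral_distr)
      also have "\<dots> < \<infinity>"
        using f(2) by (simp add: sq_integrable_def integrable_iff_bounded comp_def)
      finally have "AE x in M. ?h x * ennreal ((cmod (f x))\<^sup>2) \<noteq> \<infinity>"
        by (intro nn_integral_PInf_AE) auto
      then have zero: "AE x in M. x \<in> B \<longrightarrow> f x = 0"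
        by eventually_elim (auto simp: B_def ennreal_top_mult split: if_splits)
      have "measure M B = (\<integral>x. indicator B x \<partial>M)"
        using fin by simp
      also have "\<dots> \<le> (\<integral>x. (cmod (indicator B x - f x))\<^sup>2 \<partial>M)"
      proof (rule integral_mono_AE)
        show "integrable M (indicat_real B)"
          using fin by simp
        show "integrable M (\<lambda>x. (cmod (indicator B x - f x))\<^sup>2)"
          using sq_integrable_diff[OF B_sq f(1)] by (simp add: sq_integrable_def)
        show "AE x in M. indicat_real B x \<le> (cmod (indicator B x - f x))\<^sup>2"
          using zero by eventually_elim (auto simp: indicator_def)
      qed
      finally show False
        using v(2) unfolding f(3) L2_dist_class[OF B_sq f(1)] by simp
    qed
    then have "emeasure M B = 0"
      using fin by (simp add: emeasure_eq_ennreal_measure)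
    then have "B \<in> null_sets M"
      by (simp add: null_setsI)
    then show ?thesis
      unfolding B_def by (rule AE_not_in)
  qed
  then have "AE x in M. \<forall>i. x \<notin> {x \<in> A i. ?h x = \<infinity>}"
    unfolding AE_all_countable ..
  then show ?thesis
    using AE_space
  proof eventually_elim
    case (elim x)
    then show ?case
      using A(2) by (auto simp: less_top)
  qed
qed

section \<open>Multiplication operators and the real-valued density\<close>

definition mult_op :: "'a measure \<Rightarrow> ('a \<Rightarrow> real) \<Rightarrow> 'a L2_op" where
  "mult_op M H = {(L2_class M f, L2_class M (\<lambda>x. H x *\<^sub>R f x)) | f.
      f \<in> sq_integrable M \<and> (\<lambda>x. H x *\<^sub>R f x) \<in> sq_integrable M}"

lemma emeasure_sym_diff_vimage_eq_0_iff:
  assumes [measurable]: "\<phi> \<in> measurable M M" "A \<in> sets M" "B \<in> sets M"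
  shows "emeasure M (sym_diff A (\<phi> -` B \<inter> space M)) = 0 \<longleftrightarrow> (AE x in M. x \<in> A \<longleftrightarrow> \<phi> x \<in> B)"
proof -
  have "sym_diff A (\<phi> -` B \<inter> space M) = {x \<in> space M. \<not> (x \<in> A \<longleftrightarrow> \<phi> x \<in> B)}"
    using sets.sets_into_space[OF assms(2)] by auto
  then show ?thesis
    by (subst AE_iff_measurable[OF _ refl]) auto
qed

text \<open>Here \<open>H\<close> is a finite, everywhere nonnegative version of
  \<open>h_deriv M \<phi>\<close>, which lets Bochner integrals and real scalar multiplication be
  used directly. The density of the domain is what makes such a version available.\<close>

locale finite_composition = sigma_finite_measure M for M :: "'a measure" +
  fixes \<phi> :: "'a \<Rightarrow> 'a" and H :: "'a \<Rightarrow> real"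
  assumes nonsingular: "nonsingular M \<phi>"
    and H_measurable [measurable]: "H \<in> borel_measurable M"
    and H_nonneg [simp]: "\<And>x. 0 \<le> H x"
    and density_H: "density M H = distr M M \<phi>"
begin

lemma measurable_phi [measurable]: "\<phi> \<in> measurable M M"
  using nonsingular by (simp add: nonsingular_def)

lemmas AE_phi = AE_nonsingular[OF nonsingular]

lemma integral_comp:
  fixes g :: "'a \<Rightarrow> 'b :: {banach, second_countable_topology}"
  assumes "g \<in> borel_measurable M"
  shows "integrable M (\<lambda>x. g (\<phi> x)) \<longleftrightarrow> integrable M (\<lambda>x. H x *\<^sub>R g x)"
    and "(\<integral>x. g (\<phi> x) \<partial>M) = (\<integral>x. H x *\<^sub>R g x \<partial>M)"
  using integral_transfer[of \<phi> M "\<lambda>_. 1" H g] assms density_H by (auto simp: density_1)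

lemma comp_sq_integrable_iff:
  assumes [measurable]: "f \<in> borel_measurable M"
  shows "f \<circ> \<phi> \<in> sq_integrable M \<longleftrightarrow> integrable M (\<lambda>x. H x * (cmod (f x))\<^sup>2)"
  using integral_comp(1)[of "\<lambda>x. (cmod (f x))\<^sup>2"] by (simp add: sq_integrable_def comp_def)

text \<open>The measure with density \<open>H\<close> gives no mass to the set where
  \<open>H\<close> vanishes, and it is the image of \<open>M\<close> under
  \<open>\<phi>\<close>.\<close>

lemma H_phi_pos: "AE x in M. 0 < H (\<phi> x)"
proof -
  have "AE x in density M H. 0 < H x"
    by (simp add: AE_density)
  then show ?thesis
    unfolding density_H by (simp add: AE_distr_iff)
qed

section \<open>Small sets as test sets\<close>

text \<open>Both bounds together put the indicator of such a set into the domain of \<open>C\<close>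
  and into that of multiplication by \<open>H\<close>. Countably many of these sets exhaust the
  space, so a.e. claims can be checked on each of them.\<close>

definition small :: "'a set set" where
  "small = {E \<in> sets M. emeasure M E < \<infinity> \<and> (\<exists>c. \<forall>x\<in>E. H x \<le> c)}"

lemma small_measurable: "E \<in> small \<Longrightarrow> E \<in> sets M"
  and small_finite: "E \<in> small \<Longrightarrow> emeasure M E < \<infinity>"
  by (auto simp: small_def)

lemma small_Int: "E \<in> small \<Longrightarrow> A \<in> sets M \<Longrightarrow> A \<inter> E \<in> small"
  by (auto simp: small_def intro: le_less_trans[OF emeasure_mono])

lemma small_cover:
  obtains E :: "nat \<Rightarrow> 'a set" where "\<And>n. E n \<in> small" "(\<Union>n. E n) = space M"
proof -
  obtain A :: "nat \<Rightarrow> 'a set" where A: "range A \<subseteq> sets M" "(\<Union>i. A i) = space M"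
      "\<And>i. emeasure M (A i) \<noteq> \<infinity>" "incseq A"
    using sigma_finite_incseq by blast
  note A(1)[THEN subsetD, OF rangeI, measurable]
  define E where "E n = A n \<inter> {x \<in> space M. H x \<le> real n}" for n
  have "emeasure M (E n) \<le> emeasure M (A n)" for n
    by (rule emeasure_mono) (auto simp: E_def)
  then have "E n \<in> small" for n
    using A(3)[of n] by (auto simp: small_def E_def less_top intro: le_less_trans)
  moreover have "(\<Union>n. E n) = space M"
  proof safe
    fix x assume x: "x \<in> space M"
    obtain i where i: "x \<in> A i"
      using A(2) x by auto
    obtain j where j: "H x \<le> real j"
      using real_arch_simple by blast
    have "x \<in> E (max i j)"
      using i j incseqD[OF A(4), of i "max i j"] x by (auto simp: E_def)
    then show "x \<in> (\<Union>n. E n)" by blast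
  qed (auto simp: E_def)
  ultimately show ?thesis
    by (rule that)
qed

lemma AE_small:
  assumes "\<And>E. E \<in> small \<Longrightarrow> AE x in M. x \<in> E \<longrightarrow> P x"
  shows "AE x in M. P x"
proof -
  obtain E :: "nat \<Rightarrow> 'a set" where E: "\<And>n. E n \<in> small" "(\<Union>n. E n) = space M"
    by (rule small_cover) blast
  have "AE x in M. \<forall>n. x \<in> E n \<longrightarrow> P x"
    unfolding AE_all_countable using assms[OF E(1)] by blast
  then show ?thesis
    using AE_space by eventually_elim (use E(2) in blast)
qed

lemma small_sq_integrable:
  assumes "E \<in> small"
  shows "(indicator E :: 'a \<Rightarrow> complex) \<in> sq_integrable M"
    and "(indicator E :: 'a \<Rightarrow> complex) \<circ> \<phi> \<in> sq_integrable M"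
    and "(\<lambda>x. H x *\<^sub>R indicator E x :: complex) \<in> sq_integrable M"
proof -
  note [measurable] = small_measurable[OF assms]
  have fin: "integrable M (indicator E :: 'a \<Rightarrow> real)"
    using small_finite[OF assms] by simp
  obtain c where c: "\<And>x. x \<in> E \<Longrightarrow> H x \<le> c"
    using assms by (auto simp: small_def)
  show "(indicator E :: 'a \<Rightarrow> complex) \<in> sq_integrable M"
    using small_finite[OF assms] by (intro sq_integrable_indicator) auto
  have int: "integrable M (\<lambda>x. c * indicator E x :: real)" "integrable M (\<lambda>x. c\<^sup>2 * indicator E x :: real)"
    using fin by simp_all
  have meas: "(indicator E :: 'a \<Rightarrow> complex) \<in> borel_measurable M"
    by simp
  have "norm (H x * (cmod (indicator E x))\<^sup>2) \<le> norm (c * indicator E x :: real)" for x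
    using c[of x] by (cases "x \<in> E") auto
  then have "integrable M (\<lambda>x. H x * (cmod (indicator E x))\<^sup>2)"
    by (intro Bochner_Integration.integrable_bound[OF int(1)] AE_I2) auto
  then show "(indicator E :: 'a \<Rightarrow> complex) \<circ> \<phi> \<in> sq_integrable M"
    by (simp only: comp_sq_integrable_iff[OF meas])
  show "(\<lambda>x. H x *\<^sub>R indicator E x :: complex) \<in> sq_integrable M"
    by (rule sq_integrable_bound[OF _ int(2)]) (auto simp: indicator_def power_mono c)
qed

section \<open>The adjoint and the product \<open>C\<^sup>*C\<close>\<close>

text \<open>
  The candidate \<open>p\<close> for the adjoint is only required to be locally integrable, not square integrable;
  indicators of small sets belong to the domain and suffice to identify it.
\<close>

lemma adjoint_comp_iff:
  assumes v: "v \<in> sq_integrable M" and w: "w \<in> sq_integrable M"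
    and p [measurable]: "p \<in> borel_measurable M"
    and loc: "\<And>E. E \<in> small \<Longrightarrow> integrable M (\<lambda>x. indicator E x *\<^sub>R p x)"
    and eq: "\<And>f. f \<in> sq_integrable M \<Longrightarrow> f \<circ> \<phi> \<in> sq_integrable M \<Longrightarrow>
      (\<integral>x. f (\<phi> x) * cnj (v x) \<partial>M) = (\<integral>x. f x * cnj (p x) \<partial>M)"
  shows "(L2_class M v, L2_class M w) \<in> adjoint_op M (comp_op M \<phi>) \<longleftrightarrow> (AE x in M. w x = p x)"
proof
  note [measurable] = w[THEN sq_integrable_measurable]
  assume ae: "AE x in M. w x = p x"
  show "(L2_class M v, L2_class M w) \<in> adjoint_op M (comp_op M \<phi>)"
    unfolding adjoint_op_def
  proof (safe intro!: L2_class_in_L2 v w)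
    fix a b assume "(a, b) \<in> comp_op M \<phi>"
    then obtain f where f: "f \<in> sq_integrable M" "f \<circ> \<phi> \<in> sq_integrable M"
        "a = L2_class M f" "b = L2_class M (f \<circ> \<phi>)"
      unfolding comp_op_def by blast
    note [measurable] = f(1)[THEN sq_integrable_measurable]
    have "(\<integral>x. f x * cnj (p x) \<partial>M) = (\<integral>x. f x * cnj (w x) \<partial>M)"
    proof (rule integral_cong_AE)
      show "AE x in M. f x * cnj (p x) = f x * cnj (w x)"
        using ae by eventually_elim simp
    qed measurable
    then show "L2_inner M b (L2_class M v) = L2_inner M a (L2_class M w)"
      unfolding f(3,4) L2_inner_class[OF f(1) w] L2_inner_class[OF f(2) v]
      using eq[OF f(1,2)] by simp
  qed
next
  note [measurable] = w[THEN sq_integrable_measurable]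
  assume adj: "(L2_class M v, L2_class M w) \<in> adjoint_op M (comp_op M \<phi>)"
  show "AE x in M. w x = p x"
  proof (rule AE_small)
    fix E assume E: "E \<in> small"
    note [measurable] = small_measurable[OF E]
    let ?q = "\<lambda>x. indicator E x * cnj (w x) - cnj (indicator E x *\<^sub>R p x)"
    have int: "integrable M (\<lambda>x. indicator F x * cnj (w x))"
        "integrable M (\<lambda>x. cnj (indicator F x *\<^sub>R p x))"
        "(\<integral>x. indicator F x * cnj (w x) \<partial>M) = (\<integral>x. cnj (indicator F x *\<^sub>R p x) \<partial>M)"
      if F: "F \<in> small" for F
    proof -
      note sq = small_sq_integrable(1,2)[OF F]
      show "integrable M (\<lambda>x. indicator F x * cnj (w x))"
        by (rule integrable_mult_cnj[OF sq(1) w])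
      show "integrable M (\<lambda>x. cnj (indicator F x *\<^sub>R p x))"
        using loc[OF F] by (simp only: integrable_cnj)
      have "(L2_class M (indicator F), L2_class M (indicator F \<circ> \<phi>)) \<in> comp_op M \<phi>"
        using sq unfolding comp_op_def by blast
      then have "L2_inner M (L2_class M (indicator F \<circ> \<phi>)) (L2_class M v)
          = L2_inner M (L2_class M (indicator F)) (L2_class M w)"
        using adj unfolding adjoint_op_def by blast
      then have "(\<integral>x. indicator F (\<phi> x) * cnj (v x) \<partial>M) = (\<integral>x. indicator F x * cnj (w x) \<partial>M)"
        by (simp add: L2_inner_class sq v w)
      also have "(\<integral>x. indicator F (\<phi> x) * cnj (v x) \<partial>M) = (\<integral>x. indicator F x * cnj (p x) \<partial>M)"
        by (rule eq[OF sq])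
      also have "\<dots> = (\<integral>x. cnj (indicator F x *\<^sub>R p x) \<partial>M)"
        by (intro Bochner_Integration.integral_cong) (auto simp: indicator_def)
      finally show "(\<integral>x. indicator F x * cnj (w x) \<partial>M) = (\<integral>x. cnj (indicator F x *\<^sub>R p x) \<partial>M)"
        by simp
    qed
    \<comment> \<open>An integrable function vanishes a.e. once its integral over every measurable
      \<open>A\<close> is 0. Since \<open>A \<inter> E\<close> is again small, testing the adjoint
      relation on its indicator supplies this.\<close>
    have "AE x in M. ?q x = 0"
    proof (rule density_zero)
      show "integrable M ?q"
        using int(1,2)[OF E] by (rule Bochner_Integration.integrable_diff)
      fix A assume A: "A \<in> sets M"
      have "set_lebesgue_integral M A ?q
          = (\<integral>x. indicator (A \<inter> E) x * cnj (w x) - cnj (indicator (A \<inter> E) x *\<^sub>R p x) \<partial>M)"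
        unfolding set_lebesgue_integral_def
        by (intro Bochner_Integration.integral_cong) (auto simp: indicator_def)
      also have "\<dots> = 0"
        using int[OF small_Int[OF E A]] by (simp only: Bochner_Integration.integral_diff) simp
      finally show "set_lebesgue_integral M A ?q = 0" .
    qed
    then show "AE x in M. x \<in> E \<longrightarrow> w x = p x"
      by eventually_elim (auto simp: indicator_def)
  qed
qed

text \<open>This is \<open>C\<^sup>*(g \<circ> \<phi>) = H g\<close>, read off from the change of
  variables. Square integrability is asked of \<open>g \<circ> \<phi>\<close> alone because writing
  a given element of \<open>L2\<close> in this form controls \<open>g\<close> only along
  \<open>\<phi>\<close>.\<close>

lemma adjoint_comp_phi_iff:
  assumes g [measurable]: "g \<in> borel_measurable M" and sq: "g \<circ> \<phi> \<in> sq_integrable M"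
    and w: "w \<in> sq_integrable M"
  shows "(L2_class M (g \<circ> \<phi>), L2_class M w) \<in> adjoint_op M (comp_op M \<phi>) \<longleftrightarrow>
    (AE x in M. w x = H x *\<^sub>R g x)"
proof (rule adjoint_comp_iff[OF sq w])
  fix E assume E: "E \<in> small"
  note [measurable] = small_measurable[OF E]
  obtain c where c: "\<And>x. x \<in> E \<Longrightarrow> H x \<le> c"
    using E by (auto simp: small_def)
  \<comment> \<open>On \<open>E\<close> the function \<open>H |g|\<close> is at most
    \<open>H (1 + |g|\<^sup>2)\<close>, hence at most \<open>c + H |g|\<^sup>2\<close>. The last
    term is integrable because \<open>g \<circ> \<phi>\<close> is square integrable.\<close>
  have int: "integrable M (\<lambda>x. c * indicator E x + H x * (cmod (g x))\<^sup>2)"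
    using sq small_finite[OF E] by (auto simp: comp_sq_integrable_iff)
  have "cmod z \<le> 1 + (cmod z)\<^sup>2" for z
    using sum_squares_bound[of "cmod z" 1] norm_ge_zero[of z] unfolding power_one by linarith
  then have "H x * cmod (g x) \<le> H x * (1 + (cmod (g x))\<^sup>2)" for x
    by (intro mult_left_mono) auto
  then have "H x * cmod (g x) \<le> c + H x * (cmod (g x))\<^sup>2" if "x \<in> E" for x
    using order_trans[OF \<open>H x * cmod (g x) \<le> H x * (1 + (cmod (g x))\<^sup>2)\<close>] c[OF that]
    by (simp add: distrib_left)
  then show "integrable M (\<lambda>x. indicator E x *\<^sub>R (H x *\<^sub>R g x))"
    by (intro Bochner_Integration.integrable_bound[OF int])
       (auto simp: indicator_def c intro!: AE_I2 order_trans[OF _ abs_ge_self])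
next
  fix f assume "f \<in> sq_integrable M"
  then have [measurable]: "f \<in> borel_measurable M"
    by (rule sq_integrable_measurable)
  show "(\<integral>x. f (\<phi> x) * cnj ((g \<circ> \<phi>) x) \<partial>M) = (\<integral>x. f x * cnj (H x *\<^sub>R g x) \<partial>M)"
    using integral_comp(2)[of "\<lambda>x. f x * cnj (g x)"] by simp
qed simp

text \<open>From \<open>H \<le> 1 + H\<^sup>2\<close> follows
  \<open>H |f|\<^sup>2 \<le> |f|\<^sup>2 + |H f|\<^sup>2\<close>. Thus the maximal domain of
  multiplication by \<open>H\<close> lies inside the domain of \<open>C\<close>.\<close>

lemma comp_sq_integrable:
  assumes "f \<in> sq_integrable M" "(\<lambda>x. H x *\<^sub>R f x) \<in> sq_integrable M"
  shows "f \<circ> \<phi> \<in> sq_integrable M"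
proof -
  have [measurable]: "f \<in> borel_measurable M"
    using assms(1) by (rule sq_integrable_measurable)
  have int: "integrable M (\<lambda>x. (cmod (f x))\<^sup>2 + (cmod (H x *\<^sub>R f x))\<^sup>2)"
    using assms by (auto simp: sq_integrable_def)
  have "t * s \<le> s + t\<^sup>2 * s" if "0 \<le> t" "0 \<le> s" for s t :: real
  proof -
    have "t \<le> 1 + t\<^sup>2"
      using sum_squares_bound[of t 1] that by simp
    from mult_right_mono[OF this that(2)] show ?thesis
      by (simp add: algebra_simps)
  qed
  then have "H x * (cmod (f x))\<^sup>2 \<le> (cmod (f x))\<^sup>2 + (cmod (H x *\<^sub>R f x))\<^sup>2" for x
    by (simp add: power_mult_distrib)
  then show ?thesis
    unfolding comp_sq_integrable_iff[OF \<open>f \<in> borel_measurable M\<close>]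
    by (intro Bochner_Integration.integrable_bound[OF int])
       (auto intro!: AE_I2 order_trans[OF _ abs_ge_self])
qed

text \<open>As \<open>O\<close> applies its left factor first, the product is
  \<open>C\<^sup>*C\<close>. The adjoint formula with \<open>g = f\<close> gives the action;
  \<open>comp_sq_integrable\<close> ensures that no part of the maximal domain is lost.\<close>

lemma adjoint_comp_comp: "comp_op M \<phi> O adjoint_op M (comp_op M \<phi>) = mult_op M H"
proof (intro equalityI subrelI)
  fix u w assume "(u, w) \<in> comp_op M \<phi> O adjoint_op M (comp_op M \<phi>)"
  then obtain f where f: "f \<in> sq_integrable M" "f \<circ> \<phi> \<in> sq_integrable M" "u = L2_class M f"
      and adj: "(L2_class M (f \<circ> \<phi>), w) \<in> adjoint_op M (comp_op M \<phi>)"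
    unfolding comp_op_def by blast
  then have "w \<in> L2 M"
    by (simp add: adjoint_op_def)
  then obtain w' where w': "w' \<in> sq_integrable M" "w = L2_class M w'"
    by (rule L2_cases)
  note [measurable] = sq_integrable_measurable[OF f(1)]
  have ae: "AE x in M. w' x = H x *\<^sub>R f x"
    using adj adjoint_comp_phi_iff[OF _ f(2) w'(1)] w'(2) by simp
  then have Hf: "(\<lambda>x. H x *\<^sub>R f x) \<in> sq_integrable M"
    using w'(1) by (rule sq_integrable_cong_AE[rotated 2]) simp
  then have "w = L2_class M (\<lambda>x. H x *\<^sub>R f x)"
    unfolding w'(2) by (rule L2_class_eqI[OF w'(1) _ ae])
  with f Hf show "(u, w) \<in> mult_op M H"
    unfolding mult_op_def by blast
next
  fix u w assume "(u, w) \<in> mult_op M H"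
  then obtain f where f: "f \<in> sq_integrable M" "(\<lambda>x. H x *\<^sub>R f x) \<in> sq_integrable M"
      "u = L2_class M f" "w = L2_class M (\<lambda>x. H x *\<^sub>R f x)"
    unfolding mult_op_def by blast
  note sq = comp_sq_integrable[OF f(1,2)]
  have "(L2_class M (f \<circ> \<phi>), w) \<in> adjoint_op M (comp_op M \<phi>)"
    unfolding f(4) using adjoint_comp_phi_iff[OF sq_integrable_measurable[OF f(1)] sq f(2)] by simp
  moreover have "(u, L2_class M (f \<circ> \<phi>)) \<in> comp_op M \<phi>"
    unfolding f(3) comp_op_def using f(1) sq by blast
  ultimately show "(u, w) \<in> comp_op M \<phi> O adjoint_op M (comp_op M \<phi>)"
    by blast
qed

section \<open>Densities of restricted image measures\<close>

text \<open>The densities belonging to \<open>D\<close> and to its complement add up to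
  \<open>H\<close>, whence the bound by \<open>H\<close>. In probabilistic terms
  \<open>(k / H) \<circ> \<phi>\<close> is the conditional expectation of the indicator of
  \<open>D\<close> given the preimage sigma-algebra.\<close>

lemma restricted_density:
  assumes [measurable]: "D \<in> sets M"
  obtains k :: "'a \<Rightarrow> real" where "k \<in> borel_measurable M" "\<And>x. 0 \<le> k x" "AE x in M. k x \<le> H x"
    "density M k = distr (density M (indicat_real D)) M \<phi>"
proof -
  define N where "N A = distr (density M (indicat_real A)) M \<phi>" for A
  define r where "r A = RN_deriv M (N A)" for A
  have r_measurable [measurable]: "r A \<in> borel_measurable M" for A
    by (simp add: r_def)
  have N: "emeasure (N A) B = emeasure M (A \<inter> (\<phi> -` B \<inter> space M))"
    if [measurable]: "A \<in> sets M" "B \<in> sets M" for A B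
  proof -
    have "\<phi> \<in> measurable (density M (indicat_real A)) M"
      by simp
    then have "emeasure (N A) B = (\<integral>\<^sup>+x. ennreal (indicator A x) * indicator (\<phi> -` B \<inter> space M) x \<partial>M)"
      unfolding N_def by (simp add: emeasure_distr emeasure_density)
    also have "\<dots> = (\<integral>\<^sup>+x. indicator (A \<inter> (\<phi> -` B \<inter> space M)) x \<partial>M)"
      by (intro nn_integral_cong) (auto simp: indicator_def)
    finally show ?thesis
      by simp
  qed
  have r: "density M (r A) = N A" if A: "A \<in> sets M" for A
    unfolding r_def
  proof (rule density_RN_deriv)
    show "sets (N A) = sets M"
      by (simp add: N_def)
    show "absolutely_continuous M (N A)"
      unfolding absolutely_continuous_def
    proof
      fix B assume B: "B \<in> null_sets M"
      then have "B \<in> null_sets (distr M M \<phi>)"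
        using nonsingular by (auto simp: nonsingular_def absolutely_continuous_def)
      then have "\<phi> -` B \<inter> space M \<in> null_sets M"
        by (simp add: null_sets_distr_iff)
      then have "A \<inter> (\<phi> -` B \<inter> space M) \<in> null_sets M"
        by (rule null_set_Int1[OF _ A])
      then show "B \<in> null_sets (N A)"
        using N[OF A, of B] B by (auto simp: null_sets_def N_def)
    qed
  qed
  let ?D' = "space M - D"
  have "density M (\<lambda>x. r D x + r ?D' x) = density M H"
  proof (rule measure_eqI)
    fix B assume "B \<in> sets (density M (\<lambda>x. r D x + r ?D' x))"
    then have B [measurable]: "B \<in> sets M"
      by simp
    have "emeasure (density M (\<lambda>x. r D x + r ?D' x)) B = emeasure (density M (r D)) B + emeasure (density M (r ?D')) B"
      by (simp add: emeasure_density nn_integral_add[symmetric] distrib_right)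
    also have "\<dots> = emeasure M (D \<inter> (\<phi> -` B \<inter> space M)) + emeasure M (?D' \<inter> (\<phi> -` B \<inter> space M))"
      by (simp add: r N)
    also have "\<dots> = emeasure M (D \<inter> (\<phi> -` B \<inter> space M) \<union> ?D' \<inter> (\<phi> -` B \<inter> space M))"
      by (rule plus_emeasure) auto
    also have "D \<inter> (\<phi> -` B \<inter> space M) \<union> ?D' \<inter> (\<phi> -` B \<inter> space M) = \<phi> -` B \<inter> space M"
      by auto
    finally show "emeasure (density M (\<lambda>x. r D x + r ?D' x)) B = emeasure (density M H) B"
      unfolding density_H by (simp add: emeasure_distr)
  qed simp
  then have "AE x in M. r D x + r ?D' x = ennreal (H x)"
    by (rule density_unique[rotated 2]) measurable
  then have le: "AE x in M. r D x \<le> ennreal (H x)"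
    by eventually_elim (metis le_iff_add)
  show ?thesis
  proof (rule that)
    show "(\<lambda>x. enn2real (r D x)) \<in> borel_measurable M"
      by measurable
    show "AE x in M. enn2real (r D x) \<le> H x"
      using le by eventually_elim (simp add: enn2real_leI)
    \<comment> \<open>The bound by the finite \<open>H\<close> rules out the value
      \<open>\<infinity>\<close>, so passing to reals changes nothing a.e.\<close>
    have "AE x in M. ennreal (enn2real (r D x)) = r D x"
      using le by eventually_elim (rule ennreal_enn2real, rule le_less_trans, assumption, simp)
    then have "density M (\<lambda>x. ennreal (enn2real (r D x))) = density M (r D)"
      by (intro density_cong) measurable
    then show "density M (\<lambda>x. ennreal (enn2real (r D x))) = distr (density M (indicat_real D)) M \<phi>"
      by (simp add: r N_def)
  qed simp
qed

section \<open>Sets and functions as pullbacks along \<open>\<phi>\<close>\<close>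

text \<open>Modulo null sets, the preimage sigma-algebra is the whole sigma-algebra. The pointwise
  a.e. form replaces the symmetric difference so that such facts combine directly with other a.e.
  statements.\<close>

definition full_pullback :: bool where
  "full_pullback \<longleftrightarrow> (\<forall>A\<in>sets M. \<exists>B\<in>sets M. AE x in M. x \<in> A \<longleftrightarrow> \<phi> x \<in> B)"

text \<open>For \<open>A\<close> of finite measure, the indicator of \<open>A\<close> and
  \<open>(k / H) \<circ> \<phi>\<close> have the same integrals against every
  \<open>f \<circ> \<phi>\<close>, namely that of \<open>k f\<close>. Their difference is therefore
  annihilated by \<open>C\<^sup>*\<close> and vanishes, which makes \<open>A\<close> a.e. the
  preimage of \<open>{g = 1}\<close>.\<close>

lemma adjoint_kernel_zero_imp_full_pullback:
  assumes ker: "kernel_op M (adjoint_op M (comp_op M \<phi>)) = {L2_zero M}"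
  shows full_pullback
  unfolding full_pullback_def
proof
  have fin: "\<exists>B\<in>sets M. AE x in M. x \<in> A \<longleftrightarrow> \<phi> x \<in> B"
    if A [measurable]: "A \<in> sets M" and Afin: "emeasure M A < \<infinity>" for A
  proof -
    obtain k :: "'a \<Rightarrow> real" where k [measurable]: "k \<in> borel_measurable M" and k0: "\<And>x. 0 \<le> k x"
        and kH: "AE x in M. k x \<le> H x"
        and dens: "density M k = distr (density M (indicat_real A)) M \<phi>"
      using restricted_density[OF A] by blast
    define g where "g x = k x / H x" for x
    have [measurable]: "g \<in> borel_measurable M"
      unfolding g_def by measurable
    \<comment> \<open>Where \<open>H\<close> vanishes, division yields \<open>g = 0\<close>, and
      \<open>0 \<le> k \<le> H\<close> makes \<open>k\<close> vanish too, so the identity survives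
      there.\<close>
    have Hg: "AE x in M. k x = H x * g x"
      using kH by eventually_elim (use k0 in \<open>auto simp: g_def intro: antisym\<close>)
    have "AE x in M. 0 \<le> g x \<and> g x \<le> 1"
      using kH by eventually_elim (auto simp: g_def k0 divide_le_eq_1 less_le)
    then have g01: "AE x in M. 0 \<le> g (\<phi> x) \<and> g (\<phi> x) \<le> 1"
      by (rule AE_phi)
    have intA: "integrable M (indicat_real A)"
      using Afin by simp
    then have "integrable M k"
      using integral_transfer(1)[of \<phi> M "indicat_real A" k "\<lambda>_. 1::real"] dens k0 by simp
    then have "integrable M (\<lambda>x. H x *\<^sub>R g x)"
      by (rule integrable_cong_AE_imp) (use Hg in auto)
    then have int_g: "integrable M (\<lambda>x. g (\<phi> x))"
      by (simp add: integral_comp)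
    define p :: "'a \<Rightarrow> complex" where "p x = complex_of_real (g (\<phi> x))" for x
    have p: "p \<in> sq_integrable M"
    proof (rule sq_integrable_bound[OF _ int_g])
      show "p \<in> borel_measurable M"
        unfolding p_def by measurable
      \<comment> \<open>Values in \<open>[0, 1]\<close> are not increased by squaring, so
        integrability already gives square integrability.\<close>
      show "AE x in M. (cmod (p x))\<^sup>2 \<le> g (\<phi> x)"
        using g01 by eventually_elim (auto simp: p_def power2_eq_square intro: mult_left_le)
    qed
    have a: "indicator A \<in> sq_integrable M"
      using Afin by (intro sq_integrable_indicator) auto
    have v: "(\<lambda>x. indicator A x - p x) \<in> sq_integrable M"
      by (rule sq_integrable_diff[OF a p])
    have "(L2_class M (\<lambda>x. indicator A x - p x), L2_class M (\<lambda>x. 0)) \<in> adjoint_op M (comp_op M \<phi>)"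
    proof (subst adjoint_comp_iff[OF v, where p = "\<lambda>x. 0"])
      fix f assume f: "f \<in> sq_integrable M" "f \<circ> \<phi> \<in> sq_integrable M"
      note [measurable] = sq_integrable_measurable[OF f(1)]
      have "(\<integral>x. f (\<phi> x) * cnj (indicator A x - p x) \<partial>M)
          = (\<integral>x. (f \<circ> \<phi>) x * cnj (indicator A x) - (f \<circ> \<phi>) x * cnj (p x) \<partial>M)"
        by (simp add: algebra_simps)
      also have "\<dots> = (\<integral>x. (f \<circ> \<phi>) x * cnj (indicator A x) \<partial>M) - (\<integral>x. (f \<circ> \<phi>) x * cnj (p x) \<partial>M)"
        by (intro Bochner_Integration.integral_diff integrable_mult_cnj f a p)
      also have "(\<integral>x. (f \<circ> \<phi>) x * cnj (indicator A x) \<partial>M) = (\<integral>x. indicator A x *\<^sub>R f (\<phi> x) \<partial>M)"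
        by (intro Bochner_Integration.integral_cong) (auto simp: indicator_def)
      also have "\<dots> = (\<integral>x. k x *\<^sub>R f x \<partial>M)"
        using dens k0 by (intro integral_transfer(2)) auto
      also have "\<dots> = (\<integral>x. H x *\<^sub>R (g x *\<^sub>R f x) \<partial>M)"
      proof (rule integral_cong_AE)
        show "AE x in M. k x *\<^sub>R f x = H x *\<^sub>R g x *\<^sub>R f x"
          using Hg by eventually_elim simp
      qed measurable
      also have "\<dots> = (\<integral>x. g (\<phi> x) *\<^sub>R f (\<phi> x) \<partial>M)"
        by (rule integral_comp(2)[symmetric]) measurable
      also have "\<dots> = (\<integral>x. (f \<circ> \<phi>) x * cnj (p x) \<partial>M)"
        by (simp add: p_def scaleR_conv_of_real mult.commute)
      finally show "(\<integral>x. f (\<phi> x) * cnj (indicator A x - p x) \<partial>M) = (\<integral>x. f x * cnj 0 \<partial>M)"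
        by simp
    qed auto
    then have "L2_class M (\<lambda>x. indicator A x - p x) \<in> kernel_op M (adjoint_op M (comp_op M \<phi>))"
      by (simp add: kernel_op_def L2_zero_def)
    then have "AE x in M. indicator A x - p x = 0"
      unfolding ker L2_zero_def using v by (simp add: L2_class_eq_iff)
    then have "AE x in M. x \<in> A \<longleftrightarrow> \<phi> x \<in> {x \<in> space M. g x = 1}"
      using AE_space
    proof eventually_elim
      case (elim x)
      then have "p x = indicator A x"
        by simp
      with elim(2) show ?case
        using measurable_space[OF measurable_phi elim(2)] by (auto simp: p_def indicator_def)
    qed
    then show ?thesis
      by (intro bexI[of _ "{x \<in> space M. g x = 1}"]) auto
  qed
  \<comment> \<open>A general \<open>A\<close> is cut into pieces of finite measure by a small
    cover; the union of the sets found for the pieces works for \<open>A\<close>.\<close>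
  fix A assume A: "A \<in> sets M"
  obtain E :: "nat \<Rightarrow> 'a set" where E: "\<And>n. E n \<in> small" "(\<Union>n. E n) = space M"
    by (rule small_cover) blast
  have "\<forall>n. \<exists>B\<in>sets M. AE x in M. x \<in> A \<inter> E n \<longleftrightarrow> \<phi> x \<in> B"
    using small_Int[OF E(1) A] by (intro allI fin) (auto simp: small_def)
  then obtain B where B: "\<And>n. B n \<in> sets M" "\<And>n. AE x in M. x \<in> A \<inter> E n \<longleftrightarrow> \<phi> x \<in> B n"
    by metis
  have "AE x in M. \<forall>n. x \<in> A \<inter> E n \<longleftrightarrow> \<phi> x \<in> B n"
    unfolding AE_all_countable using B(2) ..
  then have "AE x in M. x \<in> A \<longleftrightarrow> \<phi> x \<in> (\<Union>n. B n)"
    using AE_space by eventually_elim (use E(2) in blast)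
  then show "\<exists>B\<in>sets M. AE x in M. x \<in> A \<longleftrightarrow> \<phi> x \<in> B"
    using B(1) by blast
qed

text \<open>The real function is rebuilt from preimages of its strict sublevel sets at rational levels.\<close>

lemma full_pullback_real:
  fixes u :: "'a \<Rightarrow> real"
  assumes full_pullback and [measurable]: "u \<in> borel_measurable M"
  obtains g where "g \<in> borel_measurable M" "AE x in M. u x = g (\<phi> x)"
proof -
  have "\<forall>q::rat. \<exists>B\<in>sets M. AE x in M. x \<in> {x \<in> space M. u x < of_rat q} \<longleftrightarrow> \<phi> x \<in> B"
    using assms(1) unfolding full_pullback_def by (intro allI) (erule bspec, measurable)
  then obtain B where B [measurable]: "\<And>q::rat. B q \<in> sets M"
      and ae: "\<And>q. AE x in M. x \<in> {x \<in> space M. u x < of_rat q} \<longleftrightarrow> \<phi> x \<in> B q"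
    by metis
  \<comment> \<open>Outside the image of \<open>\<phi>\<close> the infimum may be infinite, hence
    the extended real values; only \<open>G (\<phi> x)\<close> enters the conclusion.\<close>
  define G where "G x = (INF q. if x \<in> B q then ereal (of_rat q) else \<infinity>)" for x
  have [measurable]: "G \<in> borel_measurable M"
    unfolding G_def by measurable
  have inf: "(INF q::rat. if t < of_rat q then ereal (of_rat q) else \<infinity>) = ereal t" for t
  proof (rule antisym)
    show "(INF q::rat. if t < of_rat q then ereal (of_rat q) else \<infinity>) \<le> ereal t"
    proof (rule dense_ge)
      fix y assume "ereal t < y"
      then obtain q :: rat where "ereal t < real_of_rat q" "real_of_rat q < y"
        using ereal_dense3 by blast
      then show "(INF q::rat. if t < of_rat q then ereal (of_rat q) else \<infinity>) \<le> y"
        by (intro INF_lower2[of q]) auto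
    qed
    show "ereal t \<le> (INF q::rat. if t < of_rat q then ereal (of_rat q) else \<infinity>)"
      by (rule INF_greatest) simp
  qed
  have "AE x in M. \<forall>q. x \<in> {x \<in> space M. u x < of_rat q} \<longleftrightarrow> \<phi> x \<in> B q"
    unfolding AE_all_countable using ae ..
  then have "AE x in M. u x = real_of_ereal (G (\<phi> x))"
    using AE_space
  proof eventually_elim
    case (elim x)
    then have "\<phi> x \<in> B q \<longleftrightarrow> u x < of_rat q" for q
      by simp
    then show ?case
      by (simp only: G_def inf real_of_ereal.simps)
  qed
  then show ?thesis
    by (intro that[of "\<lambda>x. real_of_ereal (G x)"]) auto
qed

lemma full_pullback_complex:
  assumes full_pullback and [measurable]: "v \<in> borel_measurable M"
  obtains g :: "'a \<Rightarrow> complex" where "g \<in> borel_measurable M" "AE x in M. v x = (g \<circ> \<phi>) x"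
proof -
  obtain a where a [measurable]: "a \<in> borel_measurable M" "AE x in M. Re (v x) = a (\<phi> x)"
    by (rule full_pullback_real[OF assms(1), of "\<lambda>x. Re (v x)"]) auto
  obtain b where b [measurable]: "b \<in> borel_measurable M" "AE x in M. Im (v x) = b (\<phi> x)"
    by (rule full_pullback_real[OF assms(1), of "\<lambda>x. Im (v x)"]) auto
  show ?thesis
  proof (rule that)
    show "(\<lambda>x. complex_of_real (a x) + \<i> * complex_of_real (b x)) \<in> borel_measurable M"
      by measurable
    show "AE x in M. v x = ((\<lambda>x. complex_of_real (a x) + \<i> * complex_of_real (b x)) \<circ> \<phi>) x"
      using a(2) b(2) by eventually_elim (auto simp: complex_eq_iff)
  qed
qed

lemma full_pullback_L2_cases:
  assumes full_pullback "u \<in> L2 M"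
  obtains g where "g \<in> borel_measurable M" "g \<circ> \<phi> \<in> sq_integrable M" "u = L2_class M (g \<circ> \<phi>)"
proof -
  obtain v where v: "v \<in> sq_integrable M" "u = L2_class M v"
    using assms(2) by (rule L2_cases)
  obtain g where g [measurable]: "g \<in> borel_measurable M" and ae: "AE x in M. v x = (g \<circ> \<phi>) x"
    using full_pullback_complex[OF assms(1) sq_integrable_measurable[OF v(1)]] by blast
  have "g \<circ> \<phi> \<in> sq_integrable M"
    by (rule sq_integrable_cong_AE[OF v(1) _ ae]) (simp add: comp_def)
  moreover from this have "u = L2_class M (g \<circ> \<phi>)"
    unfolding v(2) using v(1) ae by (intro L2_class_eqI)
  ultimately show ?thesis
    using g by (intro that)
qed

lemma L2_zero_in_kernels:
  "L2_zero M \<in> kernel_op M (comp_op M \<phi>)" "L2_zero M \<in> kernel_op M (adjoint_op M (comp_op M \<phi>))"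
proof -
  show "L2_zero M \<in> kernel_op M (comp_op M \<phi>)"
    using linear_op_comp_op[OF nonsingular] by (simp add: kernel_op_def linear_op_def)
  show "L2_zero M \<in> kernel_op M (adjoint_op M (comp_op M \<phi>))"
    using adjoint_comp_phi_iff[of "\<lambda>x. 0" "\<lambda>x. 0"] by (simp add: kernel_op_def L2_zero_def comp_def)
qed

text \<open>An element of the kernel has the form \<open>g \<circ> \<phi>\<close> with
  \<open>H g = 0\<close> a.e. Composing this with \<open>\<phi>\<close> is decisive, since
  \<open>H \<circ> \<phi>\<close> is positive a.e. even where positivity of \<open>H\<close> itself
  is unknown.\<close>

lemma full_pullback_imp_adjoint_kernel_zero:
  assumes full_pullback
  shows "kernel_op M (adjoint_op M (comp_op M \<phi>)) = {L2_zero M}"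
proof (intro equalityI subsetI)
  fix u assume "u \<in> kernel_op M (adjoint_op M (comp_op M \<phi>))"
  then have adj: "(u, L2_class M (\<lambda>x. 0)) \<in> adjoint_op M (comp_op M \<phi>)"
    by (simp add: kernel_op_def L2_zero_def)
  then have "u \<in> L2 M"
    by (simp add: adjoint_op_def)
  then obtain g where g: "g \<in> borel_measurable M" "g \<circ> \<phi> \<in> sq_integrable M" "u = L2_class M (g \<circ> \<phi>)"
    by (rule full_pullback_L2_cases[OF assms])
  have "AE x in M. 0 = H x *\<^sub>R g x"
    using adj unfolding g(3) by (subst (asm) adjoint_comp_phi_iff[OF g(1,2)]) auto
  then have "AE x in M. 0 = H (\<phi> x) *\<^sub>R g (\<phi> x)"
    by (rule AE_phi)
  then have "AE x in M. (g \<circ> \<phi>) x = 0"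
    using H_phi_pos by eventually_elim simp
  then show "u \<in> {L2_zero M}"
    unfolding g(3) L2_zero_def using g(2) by (simp add: L2_class_eq_iff)
qed (use L2_zero_in_kernels in auto)

section \<open>The product \<open>CC\<^sup>*\<close>\<close>

text \<open>With \<open>v = g \<circ> \<phi>\<close> one has
  \<open>CC\<^sup>*v = (H g) \<circ> \<phi>\<close>, which is \<open>H v\<close> by invariance of
  \<open>H\<close>. What remains is the comparison of domains.\<close>

lemma comp_adjoint_comp:
  assumes full_pullback and inv: "AE x in M. H x = H (\<phi> x)"
  shows "adjoint_op M (comp_op M \<phi>) O comp_op M \<phi> = mult_op M H"
proof (intro equalityI subrelI)
  fix u z assume "(u, z) \<in> adjoint_op M (comp_op M \<phi>) O comp_op M \<phi>"
  then obtain f where f: "f \<in> sq_integrable M" "f \<circ> \<phi> \<in> sq_integrable M" "z = L2_class M (f \<circ> \<phi>)"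
      and adj: "(u, L2_class M f) \<in> adjoint_op M (comp_op M \<phi>)"
    unfolding comp_op_def by blast
  have "u \<in> L2 M"
    using adj by (simp add: adjoint_op_def)
  then obtain g where g [measurable]: "g \<in> borel_measurable M" and gsq: "g \<circ> \<phi> \<in> sq_integrable M"
      and u: "u = L2_class M (g \<circ> \<phi>)"
    by (rule full_pullback_L2_cases[OF assms(1)])
  have "AE x in M. f x = H x *\<^sub>R g x"
    using adj unfolding u by (subst (asm) adjoint_comp_phi_iff[OF g gsq f(1)])
  then have "AE x in M. f (\<phi> x) = H (\<phi> x) *\<^sub>R g (\<phi> x)"
    by (rule AE_phi)
  then have ae: "AE x in M. (f \<circ> \<phi>) x = H x *\<^sub>R (g \<circ> \<phi>) x"
    using inv by eventually_elim simp
  then have sq: "(\<lambda>x. H x *\<^sub>R (g \<circ> \<phi>) x) \<in> sq_integrable M"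
    by (rule sq_integrable_cong_AE[OF f(2), rotated]) (simp add: comp_def)
  then have "z = L2_class M (\<lambda>x. H x *\<^sub>R (g \<circ> \<phi>) x)"
    unfolding f(3) using f(2) ae by (intro L2_class_eqI)
  with gsq sq u show "(u, z) \<in> mult_op M H"
    unfolding mult_op_def by blast
next
  fix u z assume "(u, z) \<in> mult_op M H"
  then obtain v where v: "v \<in> sq_integrable M" "(\<lambda>x. H x *\<^sub>R v x) \<in> sq_integrable M"
      "u = L2_class M v" "z = L2_class M (\<lambda>x. H x *\<^sub>R v x)"
    unfolding mult_op_def by blast
  obtain g where g [measurable]: "g \<in> borel_measurable M" and gsq: "g \<circ> \<phi> \<in> sq_integrable M"
      and u: "u = L2_class M (g \<circ> \<phi>)"
    using L2_class_in_L2[OF v(1)] unfolding v(3) by (rule full_pullback_L2_cases[OF assms(1)])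
  let ?w = "\<lambda>x. H x *\<^sub>R g x"
  have "AE x in M. v x = (g \<circ> \<phi>) x"
    using u v(3) L2_class_eq_iff[OF v(1) gsq] by simp
  then have ae: "AE x in M. H x *\<^sub>R v x = (?w \<circ> \<phi>) x"
    using inv by eventually_elim simp
  have wsq: "?w \<circ> \<phi> \<in> sq_integrable M"
    by (rule sq_integrable_cong_AE[OF v(2) _ ae]) (simp add: comp_def)
  have z: "z = L2_class M (?w \<circ> \<phi>)"
    unfolding v(4) by (rule L2_class_eqI[OF v(2) wsq ae])
  have "?w \<in> sq_integrable M"
  proof (rule sq_integrable_bound)
    show "integrable M (\<lambda>x. H x * (cmod (g x))\<^sup>2 + H x * (cmod (?w x))\<^sup>2)"
      using gsq wsq by (auto simp: comp_sq_integrable_iff)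
    \<comment> \<open>Taken at \<open>t = H x\<close> and \<open>s = |g x|\<^sup>2\<close>, this
      bounds \<open>|H g|\<^sup>2\<close> by two functions that are integrable because
      \<open>g \<circ> \<phi>\<close> and \<open>(H g) \<circ> \<phi>\<close> are square
      integrable.\<close>
    have "t\<^sup>2 * s \<le> t * s + t * (t\<^sup>2 * s)" if "0 \<le> t" "0 \<le> s" for s t :: real
    proof -
      have "t * (2 * t) \<le> t * (1 + t\<^sup>2)"
        using sum_squares_bound[of t 1] that(1) by (intro mult_left_mono) auto
      then have "t\<^sup>2 \<le> t + t * t\<^sup>2"
        using zero_le_square[of t] unfolding power2_eq_square distrib_left by linarith
      from mult_right_mono[OF this that(2)] show ?thesis
        by (simp add: algebra_simps)
    qed
    then show "AE x in M. (cmod (?w x))\<^sup>2 \<le> H x * (cmod (g x))\<^sup>2 + H x * (cmod (?w x))\<^sup>2"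
      by (simp add: power_mult_distrib)
  qed measurable
  then have "(u, L2_class M ?w) \<in> adjoint_op M (comp_op M \<phi>)" "(L2_class M ?w, z) \<in> comp_op M \<phi>"
    unfolding u z using adjoint_comp_phi_iff[OF g gsq] wsq by (auto simp: comp_op_def)
  then show "(u, z) \<in> adjoint_op M (comp_op M \<phi>) O comp_op M \<phi>"
    by blast
qed

section \<open>Consequences of \<open>CC\<^sup>* = C\<^sup>*C\<close>\<close>

text \<open>The operator equation is evaluated at the indicator of \<open>D\<close>, which lies in
  the domain of multiplication by \<open>H\<close> because \<open>D\<close> is small. The adjoint
  sends this indicator to \<open>k\<close>, and applying \<open>C\<close> gives
  \<open>k \<circ> \<phi>\<close>.\<close>

lemma commuting_density:
  assumes comm: "adjoint_op M (comp_op M \<phi>) O comp_op M \<phi> = mult_op M H" and D: "D \<in> small"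
  obtains k :: "'a \<Rightarrow> real" where "k \<in> borel_measurable M" "\<And>x. 0 \<le> k x" "AE x in M. k x \<le> H x"
    "density M k = distr (density M (indicat_real D)) M \<phi>"
    "AE x in M. k (\<phi> x) = H x * indicator D x"
proof -
  note [measurable] = small_measurable[OF D]
  obtain k :: "'a \<Rightarrow> real" where k [measurable]: "k \<in> borel_measurable M" and k0: "\<And>x. 0 \<le> k x"
      and kH: "AE x in M. k x \<le> H x"
      and dens: "density M k = distr (density M (indicat_real D)) M \<phi>"
    using restricted_density[OF small_measurable[OF D]] by blast
  note sq = small_sq_integrable(1,3)[OF D]
  have "(L2_class M (indicator D), L2_class M (\<lambda>x. H x *\<^sub>R indicator D x)) \<in> mult_op M H"
    unfolding mult_op_def using sq by blast
  then obtain z where z: "(L2_class M (indicator D), z) \<in> adjoint_op M (comp_op M \<phi>)"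
      "(z, L2_class M (\<lambda>x. H x *\<^sub>R indicator D x)) \<in> comp_op M \<phi>"
    unfolding comm[symmetric] by blast
  from z(2) obtain f where f: "f \<in> sq_integrable M" "f \<circ> \<phi> \<in> sq_integrable M" "z = L2_class M f"
      and eq: "L2_class M (\<lambda>x. H x *\<^sub>R indicator D x) = L2_class M (f \<circ> \<phi>)"
    unfolding comp_op_def by blast
  note adj = z(1)[unfolded f(3)]
  have "(L2_class M (indicator D), L2_class M f) \<in> adjoint_op M (comp_op M \<phi>) \<longleftrightarrow>
      (AE x in M. f x = complex_of_real (k x))"
  proof (rule adjoint_comp_iff[OF sq(1) f(1)])
    fix E assume E: "E \<in> small"
    note [measurable] = small_measurable[OF E]
    obtain c where c: "\<And>x. x \<in> E \<Longrightarrow> H x \<le> c"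
      using E by (auto simp: small_def)
    have int: "integrable M (\<lambda>x. c * indicator E x :: real)"
      using small_finite[OF E] by simp
    have "AE x in M. norm (indicator E x *\<^sub>R complex_of_real (k x)) \<le> norm (c * indicator E x :: real)"
      using kH
    proof eventually_elim
      case (elim x)
      then show ?case
        using c[of x] k0[of x] by (cases "x \<in> E") auto
    qed
    then show "integrable M (\<lambda>x. indicator E x *\<^sub>R complex_of_real (k x))"
      by (intro Bochner_Integration.integrable_bound[OF int]) auto
  next
    fix q assume "q \<in> sq_integrable M"
    then have [measurable]: "q \<in> borel_measurable M"
      by (rule sq_integrable_measurable)
    have "(\<integral>x. q (\<phi> x) * cnj (indicator D x) \<partial>M) = (\<integral>x. indicator D x *\<^sub>R q (\<phi> x) \<partial>M)"
      by (intro Bochner_Integration.integral_cong) (auto simp: indicator_def)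
    also have "\<dots> = (\<integral>x. k x *\<^sub>R q x \<partial>M)"
      using dens k0 by (intro integral_transfer(2)) auto
    finally show "(\<integral>x. q (\<phi> x) * cnj (indicator D x) \<partial>M) = (\<integral>x. q x * cnj (complex_of_real (k x)) \<partial>M)"
      by (simp add: scaleR_conv_of_real mult.commute)
  qed simp
  then have "AE x in M. f x = complex_of_real (k x)"
    using adj by simp
  then have "AE x in M. f (\<phi> x) = complex_of_real (k (\<phi> x))"
    by (rule AE_phi)
  moreover have "AE x in M. H x *\<^sub>R indicator D x = (f \<circ> \<phi>) x"
    using eq sq(2) f(2) by (simp add: L2_class_eq_iff)
  ultimately have "AE x in M. k (\<phi> x) = H x * indicator D x"
  proof eventually_elim
    case (elim x)
    then have "complex_of_real (k (\<phi> x)) = complex_of_real (H x * indicator D x)"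
      by (cases "x \<in> D") (simp_all add: scaleR_conv_of_real)
    then show ?case
      by (simp only: of_real_eq_iff)
  qed
  with k k0 kH dens show ?thesis
    by (rule that)
qed

text \<open>For small \<open>D\<close> inside \<open>{H = 0}\<close>,
  \<open>k \<circ> \<phi> = 0\<close> a.e., so \<open>H k\<close> has integral 0 and vanishes a.e.
  Together with \<open>0 \<le> k \<le> H\<close> this forces \<open>k = 0\<close>, and the integral
  of \<open>k\<close> is the measure of \<open>D\<close>.\<close>

lemma commuting_imp_pos:
  assumes comm: "adjoint_op M (comp_op M \<phi>) O comp_op M \<phi> = mult_op M H"
  shows "AE x in M. 0 < H x"
proof (rule AE_small)
  fix E assume E: "E \<in> small"
  define D where "D = {x \<in> space M. H x = 0} \<inter> E"
  have D: "D \<in> small"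
    unfolding D_def by (rule small_Int[OF E]) measurable
  note [measurable] = small_measurable[OF D]
  obtain k :: "'a \<Rightarrow> real" where k [measurable]: "k \<in> borel_measurable M" and k0: "\<And>x. 0 \<le> k x"
      and kH: "AE x in M. k x \<le> H x"
      and dens: "density M k = distr (density M (indicat_real D)) M \<phi>"
      and k_phi: "AE x in M. k (\<phi> x) = H x * indicator D x"
    using commuting_density[OF comm D] by blast
  have k_phi0: "AE x in M. k (\<phi> x) = 0"
    using k_phi by eventually_elim (auto simp: D_def indicator_def)
  \<comment> \<open>Integrability is secured separately because a Bochner integral equal to 0 could
    also be the default value for a function that is not integrable.\<close>
  have "integrable M (\<lambda>x. k (\<phi> x))"
  proof (rule integrable_cong_AE_imp)
    show "AE x in M. 0 = k (\<phi> x)"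
      using k_phi0 by eventually_elim simp
  qed auto
  then have "integrable M (\<lambda>x. H x *\<^sub>R k x)"
    by (simp only: integral_comp(1)[OF k])
  moreover have "(\<integral>x. H x *\<^sub>R k x \<partial>M) = 0"
    unfolding integral_comp(2)[OF k, symmetric] by (rule integral_eq_zero_AE[OF k_phi0])
  ultimately have "AE x in M. H x *\<^sub>R k x = 0"
    using integral_nonneg_eq_0_iff_AE[of M "\<lambda>x. H x *\<^sub>R k x"] k0 by simp
  then have "AE x in M. k x = 0"
    using kH
  proof eventually_elim
    case (elim x)
    then show ?case
      using k0[of x] by (cases "H x = 0") auto
  qed
  then have "(\<integral>x. k x \<partial>M) = 0"
    by (rule integral_eq_zero_AE)
  then have "measure M D = 0"
    using integral_transfer(2)[of \<phi> M "indicat_real D" k "\<lambda>_. 1::real"] dens k0 by simp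
  then have "emeasure M D = 0"
    using small_finite[OF D] by (simp add: emeasure_eq_ennreal_measure less_top)
  then have "AE x in M. x \<notin> D"
    by (intro AE_not_in) (simp add: null_setsI)
  then show "AE x in M. x \<in> E \<longrightarrow> 0 < H x"
    using AE_space by eventually_elim (auto simp: D_def less_le)
qed

text \<open>Positivity of \<open>H\<close> turns \<open>k \<circ> \<phi> = H 1\<^sub>D\<close> into
  \<open>D = \<phi>\<^sup>-\<^sup>1 S\<close> a.e. Hence \<open>H 1\<^sub>S\<close> is a second
  density of the same measure, so \<open>k = H 1\<^sub>S\<close> a.e.; composing with
  \<open>\<phi>\<close> compares \<open>H\<close> and \<open>H \<circ> \<phi>\<close> on
  \<open>D\<close>.\<close>

lemma commuting_imp_invariant:
  assumes comm: "adjoint_op M (comp_op M \<phi>) O comp_op M \<phi> = mult_op M H"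
  shows "AE x in M. H x = H (\<phi> x)"
proof (rule AE_small)
  fix D assume D: "D \<in> small"
  note [measurable] = small_measurable[OF D]
  obtain k :: "'a \<Rightarrow> real" where k [measurable]: "k \<in> borel_measurable M" and k0: "\<And>x. 0 \<le> k x"
      and kH: "AE x in M. k x \<le> H x"
      and dens: "density M k = distr (density M (indicat_real D)) M \<phi>"
      and k_phi: "AE x in M. k (\<phi> x) = H x * indicator D x"
    using commuting_density[OF comm D] by blast
  define S where "S = {x \<in> space M. 0 < k x}"
  have S [measurable]: "S \<in> sets M"
    unfolding S_def by measurable
  have D_S: "AE x in M. indicat_real D x = indicator S (\<phi> x)"
    using k_phi commuting_imp_pos[OF comm] AE_space
  proof eventually_elim
    case (elim x)
    then show ?case
      using measurable_space[OF measurable_phi elim(3)] by (auto simp: S_def indicator_def)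
  qed
  \<comment> \<open>Both measures assign to \<open>B\<close> the measure of
    \<open>D \<inter> \<phi>\<^sup>-\<^sup>1 B\<close>.\<close>
  have "density M k = density M (\<lambda>x. H x * indicator S x)"
  proof (rule measure_eqI)
    fix B assume "B \<in> sets (density M k)"
    then have [measurable]: "B \<in> sets M"
      by simp
    have "\<phi> \<in> measurable (density M (indicat_real D)) M"
      by simp
    then have "emeasure (density M k) B = (\<integral>\<^sup>+x. ennreal (indicator D x) * indicator B (\<phi> x) \<partial>M)"
      unfolding dens
      by (simp add: emeasure_distr emeasure_density)
         (intro nn_integral_cong, auto simp: indicator_def)
    also have "\<dots> = (\<integral>\<^sup>+x. ennreal (indicator S (\<phi> x)) * indicator B (\<phi> x) \<partial>M)"
      by (rule nn_integral_cong_AE) (use D_S in eventually_elim, simp)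
    also have "\<dots> = (\<integral>\<^sup>+x. ennreal (indicator S x) * indicator B x \<partial>distr M M \<phi>)"
      by (simp add: nn_integral_distr)
    also have "\<dots> = (\<integral>\<^sup>+x. ennreal (H x) * (ennreal (indicator S x) * indicator B x) \<partial>M)"
      unfolding density_H[symmetric] by (simp add: nn_integral_density)
    also have "\<dots> = emeasure (density M (\<lambda>x. H x * indicator S x)) B"
      by (simp add: emeasure_density ennreal_mult mult.assoc)
    finally show "emeasure (density M k) B = emeasure (density M (\<lambda>x. H x * indicator S x)) B" .
  qed simp
  then have "AE x in M. ennreal (k x) = ennreal (H x * indicator S x)"
    by (rule density_unique[rotated 2]) measurable
  then have "AE x in M. k x = H x * indicator S x"
    by eventually_elim (simp add: k0 indicator_def split: if_splits)
  then have "AE x in M. k (\<phi> x) = H (\<phi> x) * indicator S (\<phi> x)"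
    by (rule AE_phi)
  then show "AE x in M. x \<in> D \<longrightarrow> H x = H (\<phi> x)"
    using k_phi D_S by eventually_elim (auto simp: indicator_def split: if_splits)
qed

text \<open>If \<open>C\<^sup>*u = 0\<close>, then \<open>u\<close> lies in the domain of
  \<open>CC\<^sup>*\<close>, so \<open>H u = 0\<close> a.e., and \<open>H\<close> is positive
  a.e.\<close>

lemma commuting_imp_adjoint_kernel:
  assumes comm: "adjoint_op M (comp_op M \<phi>) O comp_op M \<phi> = mult_op M H"
  shows "kernel_op M (adjoint_op M (comp_op M \<phi>)) = {L2_zero M}"
proof (intro equalityI subsetI)
  fix u assume "u \<in> kernel_op M (adjoint_op M (comp_op M \<phi>))"
  then have "(u, L2_zero M) \<in> adjoint_op M (comp_op M \<phi>) O comp_op M \<phi>"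
    using L2_zero_in_kernels(1) by (auto simp: kernel_op_def)
  then obtain f where f: "f \<in> sq_integrable M" "(\<lambda>x. H x *\<^sub>R f x) \<in> sq_integrable M"
      "u = L2_class M f" "L2_zero M = L2_class M (\<lambda>x. H x *\<^sub>R f x)"
    unfolding comm mult_op_def by blast
  have "AE x in M. 0 = H x *\<^sub>R f x"
    using f(4) L2_class_eq_iff[OF sq_integrable_zero f(2)] by (simp add: L2_zero_def)
  then have "AE x in M. f x = 0"
    using commuting_imp_pos[OF comm] by eventually_elim auto
  then show "u \<in> {L2_zero M}"
    using f(1) by (simp add: f(3) L2_zero_def L2_class_eq_iff)
qed (use L2_zero_in_kernels in auto)

section \<open>Kernels and the equivalences\<close>

text \<open>The function \<open>f \<circ> \<phi>\<close> vanishes a.e. exactly when \<open>f\<close>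
  vanishes a.e. for the image measure, that is, a.e. on \<open>{H > 0}\<close>.\<close>

lemma comp_kernel_zero:
  assumes pos: "AE x in M. 0 < H x"
  shows "kernel_op M (comp_op M \<phi>) = {L2_zero M}"
proof (intro equalityI subsetI)
  fix u assume "u \<in> kernel_op M (comp_op M \<phi>)"
  then obtain f where f: "f \<in> sq_integrable M" "f \<circ> \<phi> \<in> sq_integrable M"
      "u = L2_class M f" "L2_zero M = L2_class M (f \<circ> \<phi>)"
    by (auto simp: kernel_op_def comp_op_def)
  note [measurable] = sq_integrable_measurable[OF f(1)]
  have "AE x in M. 0 = (f \<circ> \<phi>) x"
    using f(4) L2_class_eq_iff[OF sq_integrable_zero f(2)] by (simp add: L2_zero_def)
  then have "AE x in M. f (\<phi> x) = 0"
    by eventually_elim simp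
  then have "AE x in density M H. f x = 0"
    unfolding density_H by (simp add: AE_distr_iff)
  then have "AE x in M. 0 < H x \<longrightarrow> f x = 0"
    by (simp add: AE_density)
  then have "AE x in M. f x = 0"
    using pos by eventually_elim simp
  then show "u \<in> {L2_zero M}"
    using f(1) by (simp add: f(3) L2_zero_def L2_class_eq_iff)
qed (use L2_zero_in_kernels in auto)

lemma invariant_imp_pos:
  assumes "AE x in M. H x = H (\<phi> x)"
  shows "AE x in M. 0 < H x"
  using assms H_phi_pos by eventually_elim simp

lemma full_pullback_iff_adjoint_kernel_zero:
  "full_pullback \<longleftrightarrow> kernel_op M (adjoint_op M (comp_op M \<phi>)) = {L2_zero M}"
  using full_pullback_imp_adjoint_kernel_zero adjoint_kernel_zero_imp_full_pullback by blast

lemma normal_iff: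
  assumes "dense_in_L2 M (Domain (comp_op M \<phi>))"
  shows "normal_op M (comp_op M \<phi>) \<longleftrightarrow>
    (AE x in M. H x = H (\<phi> x)) \<and> kernel_op M (adjoint_op M (comp_op M \<phi>)) = {L2_zero M}"
proof -
  \<comment> \<open>Linearity and closedness hold for every nonsingular \<open>\<phi>\<close>, and
    \<open>C\<^sup>*C\<close> is already known, so normality comes down to the value of
    \<open>CC\<^sup>*\<close>.\<close>
  have "normal_op M (comp_op M \<phi>) \<longleftrightarrow> adjoint_op M (comp_op M \<phi>) O comp_op M \<phi> = mult_op M H"
    unfolding normal_op_def adjoint_comp_comp
    using linear_op_comp_op[OF nonsingular] closed_comp_op[OF nonsingular] assms by auto
  then show ?thesis
    using commuting_imp_invariant commuting_imp_adjoint_kernel comp_adjoint_comp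
      adjoint_kernel_zero_imp_full_pullback by blast
qed

text \<open>Invariance and positivity of \<open>H \<circ> \<phi>\<close> make \<open>H\<close>
  positive a.e., so the kernel of \<open>C\<close> on the right of the inclusion is trivial.\<close>

lemma adjoint_kernel_subset_iff:
  assumes "AE x in M. H x = H (\<phi> x)"
  shows "kernel_op M (adjoint_op M (comp_op M \<phi>)) \<subseteq> kernel_op M (comp_op M \<phi>) \<longleftrightarrow>
    kernel_op M (adjoint_op M (comp_op M \<phi>)) = {L2_zero M}"
  using comp_kernel_zero[OF invariant_imp_pos[OF assms]] L2_zero_in_kernels by auto

lemma full_pullback_iff_sym_diff:
  "full_pullback \<longleftrightarrow> (\<forall>A\<in>sets M. \<exists>B\<in>sets M. emeasure M (sym_diff A (\<phi> -` B \<inter> space M)) = 0)"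
  unfolding full_pullback_def by (simp add: emeasure_sym_diff_vimage_eq_0_iff cong: bex_cong)

end

theorem proposition8p2:
  fixes M :: "'a measure" and \<phi> :: "'a \<Rightarrow> 'a"
  assumes "sigma_finite_measure M"
    and "nonsingular M \<phi>"
    and "dense_in_L2 M (Domain (comp_op M \<phi>))"
  shows
    "(normal_op M (comp_op M \<phi>) \<longleftrightarrow>
        (AE x in M. h_deriv M \<phi> x = h_deriv M \<phi> (\<phi> x)) \<and>
        kernel_op M (adjoint_op M (comp_op M \<phi>)) \<subseteq> kernel_op M (comp_op M \<phi>)) \<and>
     (normal_op M (comp_op M \<phi>) \<longleftrightarrow>
        (AE x in M. h_deriv M \<phi> x = h_deriv M \<phi> (\<phi> x)) \<and>
        kernel_op M (adjoint_op M (comp_op M \<phi>)) = {L2_zero M}) \<and>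
     (normal_op M (comp_op M \<phi>) \<longleftrightarrow>
        (AE x in M. h_deriv M \<phi> x = h_deriv M \<phi> (\<phi> x)) \<and>
        (\<forall>\<Delta> \<in> sets M. \<exists>\<Delta>' \<in> sets M.
           emeasure M (sym_diff \<Delta> (\<phi> -` \<Delta>' \<inter> space M)) = 0)) \<and>
     (normal_op M (comp_op M \<phi>) \<longrightarrow>
        kernel_op M (comp_op M \<phi>) = {L2_zero M} \<and> (AE x in M. h_deriv M \<phi> x > 0))"
proof -
  interpret sigma_finite_measure M by fact
  \<comment> \<open>\<open>enn2real\<close> sends \<open>\<infinity>\<close> to 0; by density of the
    domain this alters the derivative on a null set only.\<close>
  define H where "H x = enn2real (h_deriv M \<phi> x)" for x
  note h_deriv_measurable[measurable]
  have H [measurable]: "H \<in> borel_measurable M"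
    unfolding H_def by measurable
  have hH: "AE x in M. h_deriv M \<phi> x = ennreal (H x)"
    using dense_imp_h_deriv_finite[OF assms] by eventually_elim (simp add: H_def)
  have "density M (h_deriv M \<phi>) = distr M M \<phi>"
    using assms(2) unfolding h_deriv_def nonsingular_def by (intro density_RN_deriv) auto
  moreover have "density M (h_deriv M \<phi>) = density M H"
    by (rule density_cong[OF _ _ hH]) measurable
  ultimately interpret finite_composition M \<phi> H
    using assms(2) by unfold_locales (auto simp: H_def)
  have "(AE x in M. h_deriv M \<phi> x = h_deriv M \<phi> (\<phi> x)) \<longleftrightarrow> (AE x in M. H x = H (\<phi> x))"
  proof (rule eventually_cong)
    show "AE x in M. h_deriv M \<phi> x = ennreal (H x) \<and> h_deriv M \<phi> (\<phi> x) = ennreal (H (\<phi> x))"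
      using hH AE_phi[OF hH] by eventually_elim simp
  qed auto
  moreover have "(AE x in M. h_deriv M \<phi> x > 0) \<longleftrightarrow> (AE x in M. 0 < H x)"
    by (rule eventually_cong[OF hH]) simp
  \<comment> \<open>Each condition is reduced to invariance of \<open>H\<close> together with
    triviality of the kernel of \<open>C\<^sup>*\<close>.\<close>
  ultimately show ?thesis
    unfolding normal_iff[OF assms(3)] full_pullback_iff_sym_diff[symmetric]
      full_pullback_iff_adjoint_kernel_zero
    using adjoint_kernel_subset_iff comp_kernel_zero invariant_imp_pos by auto
qed

end
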